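(* Tsirelson's space $T$ is not iteration stable.
   Context: Definition of $T$: let $c_{00}$ be the space of finitely supported real sequences. For $x\in c_{00}$ and $E\subseteq\mathbb{N}$ let $Ex(i)=x(i)$ if $i\in E$ and $Ex(i)=0$ otherwise; $E<F$ means $\max E<\min F$, and $n\le E$ means $n\le\min E$. $T$ is the completion of $c_{00}$ under the norm satisfying the implicit equation $$\|x\|=\max\Big(\|x\|_\infty,\ \sup\frac12\sum_{i=1}^n\|E_ix\|\Big),$$ where the sup is taken over all $n\ge2$ and $n\le E_1<\cdots<E_n$. A sequence $(x_n)$ in a Banach space $X$ is type determining if for all $x\in X$, $\lim_{n\to\infty}\|x+x_n\|$ exists. A Banach space $X$ is iteration stable if for all type determining sequences $(x_n)$ and $(y_n)$ in $X$, $\lim_{n\to\infty}\lim_{m\to\infty}\|x_n+y_m\|$ exists. *)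

theory Defs
  imports "HOL-Analysis.Analysis"
begin

section \<open>Finitely supported sequences\<close>

text \<open>Sequences are indexed by \<open>{1, 2, \<dots>}\<close>; the unused coordinate \<open>0\<close> is forced to vanish.\<close>

typedef c00 = "{x :: nat \<Rightarrow> real. finite {i. x i \<noteq> 0} \<and> x 0 = 0}"
  morphisms coord Abs_c00
  by (rule exI[of _ "\<lambda>_. 0"]) simp

setup_lifting type_definition_c00

lemma c00_eqI: "(\<And>i. coord x i = coord y i) \<Longrightarrow> x = y"
  by (metis coord_inject ext)

instantiation c00 :: real_vector
begin

lift_definition zero_c00 :: c00 is "\<lambda>_. 0" by simp

lift_definition plus_c00 :: "c00 \<Rightarrow> c00 \<Rightarrow> c00" is "\<lambda>x y i. x i + y i"
proof -
  fix x y :: "nat \<Rightarrow> real"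
  assume a: "finite {i. x i \<noteq> 0} \<and> x 0 = 0" and b: "finite {i. y i \<noteq> 0} \<and> y 0 = 0"
  have "{i. x i + y i \<noteq> 0} \<subseteq> {i. x i \<noteq> 0} \<union> {i. y i \<noteq> 0}" by auto
  with a b show "finite {i. x i + y i \<noteq> 0} \<and> x 0 + y 0 = 0"
    by (auto intro: finite_subset)
qed

lift_definition minus_c00 :: "c00 \<Rightarrow> c00 \<Rightarrow> c00" is "\<lambda>x y i. x i - y i"
proof -
  fix x y :: "nat \<Rightarrow> real"
  assume a: "finite {i. x i \<noteq> 0} \<and> x 0 = 0" and b: "finite {i. y i \<noteq> 0} \<and> y 0 = 0"
  have "{i. x i - y i \<noteq> 0} \<subseteq> {i. x i \<noteq> 0} \<union> {i. y i \<noteq> 0}" by auto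
  with a b show "finite {i. x i - y i \<noteq> 0} \<and> x 0 - y 0 = 0"
    by (auto intro: finite_subset)
qed

lift_definition uminus_c00 :: "c00 \<Rightarrow> c00" is "\<lambda>x i. - x i" by simp

lift_definition scaleR_c00 :: "real \<Rightarrow> c00 \<Rightarrow> c00" is "\<lambda>c x i. c * x i"
  by (auto elim: rev_finite_subset)

instance
  by standard (transfer; simp add: algebra_simps)+

end

lemmas coord_simps = zero_c00.rep_eq plus_c00.rep_eq minus_c00.rep_eq uminus_c00.rep_eq
  scaleR_c00.rep_eq

section \<open>Tsirelson's norm\<close>

lift_definition restr :: "nat set \<Rightarrow> c00 \<Rightarrow> c00" is "\<lambda>E x i. if i \<in> E then x i else 0"
  by (auto elim: rev_finite_subset)

definition sup_norm :: "c00 \<Rightarrow> real"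
  where "sup_norm x = (SUP i. \<bar>coord x i\<bar>)"

text \<open>\<open>n \<ge> 2\<close> and \<open>n \<le> E 1 < \<dots> < E n\<close>. The sets are nonempty, as required for \<open>min\<close> and \<open>max\<close>
  to make sense; only the last one may be infinite.\<close>

definition admissible :: "nat \<Rightarrow> (nat \<Rightarrow> nat set) \<Rightarrow> bool"
  where "admissible n E \<longleftrightarrow> 2 \<le> n \<and> (\<forall>i\<in>{1..n}. E i \<noteq> {}) \<and> (\<forall>a\<in>E 1. n \<le> a) \<and>
    (\<forall>i\<in>{1..<n}. \<forall>a\<in>E i. \<forall>b\<in>E (Suc i). a < b)"

definition tsirelson_sums :: "(c00 \<Rightarrow> real) \<Rightarrow> c00 \<Rightarrow> real set"
  where "tsirelson_sums N x = {1/2 * (\<Sum>i=1..n. N (restr (E i) x)) | n E. admissible n E}"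

definition is_norm :: "('a::real_vector \<Rightarrow> real) \<Rightarrow> bool"
  where "is_norm N \<longleftrightarrow> (\<forall>x. 0 \<le> N x) \<and> (\<forall>x. N x = 0 \<longleftrightarrow> x = 0) \<and>
    (\<forall>x y. N (x + y) \<le> N x + N y) \<and> (\<forall>c x. N (c *\<^sub>R x) = \<bar>c\<bar> * N x)"

text \<open>\<open>Sup\<close> on the reals is unspecified on unbounded sets, hence the boundedness requirement;
  the set of sums is never empty (\<open>tsirelson_sums_nonempty\<close>). Exactly one norm satisfies the
  equation (\<open>ex1_tsirelson_norm\<close>), so the definite description below is meaningful.\<close>

definition is_tsirelson_norm :: "(c00 \<Rightarrow> real) \<Rightarrow> bool"
  where "is_tsirelson_norm N \<longleftrightarrow> is_norm N \<and>
    (\<forall>x. bdd_above (tsirelson_sums N x) \<and> N x = max (sup_norm x) (Sup (tsirelson_sums N x)))"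

definition tsirelson_norm :: "c00 \<Rightarrow> real"
  where "tsirelson_norm = (THE N. is_tsirelson_norm N)"

subsection \<open>Existence and uniqueness of the norm\<close>

definition supp :: "c00 \<Rightarrow> nat set"
  where "supp x = {i. coord x i \<noteq> 0}"

definition ell1 :: "c00 \<Rightarrow> real"
  where "ell1 x = (\<Sum>i\<in>supp x. \<bar>coord x i\<bar>)"

lemma finite_supp: "finite (supp x)"
  using coord[of x] by (simp add: supp_def)

lemma supp_restr: "supp (restr E x) = supp x \<inter> E"
  by (auto simp: supp_def restr.rep_eq)

lemma restr_add: "restr E (x + y) = restr E x + restr E y"
  by (rule c00_eqI) (simp add: restr.rep_eq coord_simps)

lemma restr_scale: "restr E (c *\<^sub>R x) = c *\<^sub>R restr E x"
  by (rule c00_eqI) (simp add: restr.rep_eq coord_simps)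

lemma abs_coord_le_ell1: "\<bar>coord x i\<bar> \<le> ell1 x"
proof (cases "i \<in> supp x")
  case True
  then show ?thesis unfolding ell1_def
    by (intro member_le_sum[of i "supp x" "\<lambda>i. \<bar>coord x i\<bar>"]) (auto simp: finite_supp)
next
  case False
  then show ?thesis by (auto simp: supp_def ell1_def intro: sum_nonneg)
qed

lemma bdd_sup_norm: "bdd_above (range (\<lambda>i. \<bar>coord x i\<bar>))"
  by (rule bdd_aboveI[of _ "ell1 x"]) (auto simp: abs_coord_le_ell1)

lemma abs_coord_le_sup_norm: "\<bar>coord x i\<bar> \<le> sup_norm x"
  unfolding sup_norm_def by (rule cSUP_upper[OF _ bdd_sup_norm]) simp

lemma sup_norm_nonneg: "0 \<le> sup_norm x"
  using abs_coord_le_sup_norm[of x 0] by linarith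

lemma sup_norm_le: "(\<And>i. \<bar>coord x i\<bar> \<le> c) \<Longrightarrow> sup_norm x \<le> c"
  unfolding sup_norm_def by (rule cSUP_least) auto

lemma sup_norm_add: "sup_norm (x + y) \<le> sup_norm x + sup_norm y"
proof (rule sup_norm_le)
  fix i
  show "\<bar>coord (x + y) i\<bar> \<le> sup_norm x + sup_norm y"
    using abs_coord_le_sup_norm[of x i] abs_coord_le_sup_norm[of y i] by (simp add: coord_simps)
qed

lemma sup_norm_scale_le: "sup_norm (c *\<^sub>R x) \<le> \<bar>c\<bar> * sup_norm x"
  by (rule sup_norm_le) (simp add: coord_simps abs_mult mult_left_mono abs_coord_le_sup_norm)

lemma admissible_less:
  assumes "admissible n E" "1 \<le> i" "i < j" "j \<le> n" "a \<in> E i" "b \<in> E j"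
  shows "a < b"
  using assms(3-6)
proof (induction j arbitrary: b)
  case 0
  then show ?case by simp
next
  case (Suc j)
  have "j \<in> {1..<n}" using assms(2) Suc.prems by auto
  then have step: "\<And>c. c \<in> E j \<Longrightarrow> c < b"
    using assms(1) Suc.prems unfolding admissible_def by blast
  show ?case
  proof (cases "i = j")
    case True
    then show ?thesis using step Suc.prems by auto
  next
    case False
    have "E j \<noteq> {}" using assms(1,2) Suc.prems False unfolding admissible_def by auto
    then obtain c where "c \<in> E j" by auto
    then show ?thesis using Suc.IH[of c] step[of c] Suc.prems False by auto
  qed
qed

lemma admissible_unique:
  assumes "admissible n E" "i \<in> {1..n}" "j \<in> {1..n}" "a \<in> E i" "a \<in> E j"
  shows "i = j"
  using admissible_less[OF assms(1), of i j a a] admissible_less[OF assms(1), of j i a a] assms(2-)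
  by (cases i j rule: linorder_cases) auto

lemma ex_admissible: "admissible 2 (\<lambda>i. {Suc i})"
  by (auto simp: admissible_def)

lemma tsirelson_sumsI:
  "admissible n E \<Longrightarrow> 1/2 * (\<Sum>i=1..n. N (restr (E i) x)) \<in> tsirelson_sums N x"
  unfolding tsirelson_sums_def by blast

lemma tsirelson_sumsE:
  assumes "s \<in> tsirelson_sums N x"
  obtains n E where "s = 1/2 * (\<Sum>i=1..n. N (restr (E i) x))" "admissible n E"
  using assms unfolding tsirelson_sums_def by blast

lemma tsirelson_sums_nonempty: "tsirelson_sums N x \<noteq> {}"
  unfolding tsirelson_sums_def using ex_admissible by blast

lemma ell1_restr: "ell1 (restr E x) = (\<Sum>a\<in>supp x. if a \<in> E then \<bar>coord x a\<bar> else 0)"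
  unfolding ell1_def supp_restr
  by (subst sum.inter_restrict) (auto simp: finite_supp restr.rep_eq intro: sum.cong)

lemma sum_ell1_restr:
  assumes "admissible n E"
  shows "(\<Sum>i=1..n. ell1 (restr (E i) x)) \<le> ell1 x"
proof -
  have "(\<Sum>i=1..n. ell1 (restr (E i) x))
      = (\<Sum>a\<in>supp x. \<Sum>i=1..n. if a \<in> E i then \<bar>coord x a\<bar> else 0)"
    unfolding ell1_restr by (rule sum.swap)
  also have "\<dots> \<le> (\<Sum>a\<in>supp x. \<bar>coord x a\<bar>)"
  proof (rule sum_mono)
    fix a
    show "(\<Sum>i=1..n. if a \<in> E i then \<bar>coord x a\<bar> else 0) \<le> \<bar>coord x a\<bar>"
    proof (cases "\<exists>j\<in>{1..n}. a \<in> E j")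
      case True
      then obtain j where j: "j \<in> {1..n}" "a \<in> E j" by auto
      have "a \<in> E i \<longleftrightarrow> i = j" if "i \<in> {1..n}" for i
        using admissible_unique[OF assms that j(1) _ j(2)] j(2) by blast
      then have "(\<Sum>i=1..n. if a \<in> E i then \<bar>coord x a\<bar> else 0)
          = (\<Sum>i=1..n. if i = j then \<bar>coord x a\<bar> else 0)"
        by (intro sum.cong) simp_all
      then show ?thesis using j by simp
    next
      case False
      then have "(\<Sum>i=1..n. if a \<in> E i then \<bar>coord x a\<bar> else 0) = 0"
        by (intro sum.neutral) auto
      then show ?thesis by simp
    qed
  qed
  finally show ?thesis by (simp add: ell1_def)
qed

definition tsirelson_step :: "(c00 \<Rightarrow> real) \<Rightarrow> c00 \<Rightarrow> real"
  where "tsirelson_step N x = max (sup_norm x) (Sup (tsirelson_sums N x))"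

lemma tsirelson_sums_le_ell1:
  assumes "\<And>x. N x \<le> ell1 x" "s \<in> tsirelson_sums N x"
  shows "s \<le> ell1 x"
proof -
  obtain n E where s: "s = 1/2 * (\<Sum>i=1..n. N (restr (E i) x))" and "admissible n E"
    using assms(2) by (rule tsirelson_sumsE)
  have "(\<Sum>i=1..n. N (restr (E i) x)) \<le> (\<Sum>i=1..n. ell1 (restr (E i) x))"
    by (rule sum_mono) (rule assms(1))
  also have "\<dots> \<le> ell1 x" by (rule sum_ell1_restr) fact
  finally have "s \<le> 1/2 * ell1 x" using s by simp
  moreover have "0 \<le> ell1 x" by (rule order_trans[OF abs_ge_zero abs_coord_le_ell1])
  ultimately show ?thesis by simp
qed

lemma bdd_tsirelson_sums:
  assumes "\<And>x. N x \<le> ell1 x"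
  shows "bdd_above (tsirelson_sums N x)"
  by (rule bdd_aboveI[of _ "ell1 x"]) (rule tsirelson_sums_le_ell1[OF assms])

lemma tsirelson_step_le:
  assumes "sup_norm x \<le> c" "\<And>n E. admissible n E \<Longrightarrow> 1/2 * (\<Sum>i=1..n. N (restr (E i) x)) \<le> c"
  shows "tsirelson_step N x \<le> c"
proof -
  have "Sup (tsirelson_sums N x) \<le> c"
    by (rule cSup_least[OF tsirelson_sums_nonempty]) (metis tsirelson_sumsE assms(2))
  with assms(1) show ?thesis by (simp add: tsirelson_step_def)
qed

lemma tsirelson_step_ge:
  assumes "\<And>x. N x \<le> ell1 x" "admissible n E"
  shows "1/2 * (\<Sum>i=1..n. N (restr (E i) x)) \<le> tsirelson_step N x"
proof -
  have "1/2 * (\<Sum>i=1..n. N (restr (E i) x)) \<le> Sup (tsirelson_sums N x)"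
    by (intro cSup_upper bdd_tsirelson_sums tsirelson_sumsI assms)
  then show ?thesis by (simp add: tsirelson_step_def)
qed

lemma tsirelson_step_ge_sup: "sup_norm x \<le> tsirelson_step N x"
  by (simp add: tsirelson_step_def)

lemma tsirelson_step_le_ell1:
  assumes "\<And>x. N x \<le> ell1 x"
  shows "tsirelson_step N x \<le> ell1 x"
proof (rule tsirelson_step_le)
  show "sup_norm x \<le> ell1 x" by (rule sup_norm_le) (rule abs_coord_le_ell1)
  fix n E assume "admissible n E"
  then show "1/2 * (\<Sum>i=1..n. N (restr (E i) x)) \<le> ell1 x"
    by (intro tsirelson_sums_le_ell1[OF assms] tsirelson_sumsI)
qed

lemma tsirelson_step_mono:
  assumes "\<And>x. N x \<le> M x" "\<And>x. M x \<le> ell1 x"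
  shows "tsirelson_step N x \<le> tsirelson_step M x"
proof (rule tsirelson_step_le[OF tsirelson_step_ge_sup])
  fix n E assume a: "admissible n E"
  have "1/2 * (\<Sum>i=1..n. N (restr (E i) x)) \<le> 1/2 * (\<Sum>i=1..n. M (restr (E i) x))"
    by (intro mult_left_mono sum_mono assms(1)) simp
  also have "\<dots> \<le> tsirelson_step M x" by (rule tsirelson_step_ge[OF assms(2) a])
  finally show "1/2 * (\<Sum>i=1..n. N (restr (E i) x)) \<le> tsirelson_step M x" .
qed

primrec tsirelson_iter :: "nat \<Rightarrow> c00 \<Rightarrow> real"
  where
    "tsirelson_iter 0 = sup_norm"
  | "tsirelson_iter (Suc k) = tsirelson_step (tsirelson_iter k)"

lemma iter_le_ell1: "tsirelson_iter k x \<le> ell1 x"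
proof (induction k arbitrary: x)
  case 0
  show ?case by (auto intro: sup_norm_le abs_coord_le_ell1)
next
  case (Suc k)
  show ?case using tsirelson_step_le_ell1[OF Suc.IH] by simp
qed

lemma iter_mono: "tsirelson_iter k x \<le> tsirelson_iter (Suc k) x"
proof (induction k arbitrary: x)
  case 0
  show ?case by (simp add: tsirelson_step_ge_sup)
next
  case (Suc k)
  have "tsirelson_step (tsirelson_iter k) x \<le> tsirelson_step (tsirelson_iter (Suc k)) x"
    by (rule tsirelson_step_mono[OF Suc.IH iter_le_ell1])
  then show ?case by simp
qed

lemma iter_add: "tsirelson_iter k (x + y) \<le> tsirelson_iter k x + tsirelson_iter k y"
proof (induction k arbitrary: x y)
  case 0
  show ?case by (simp add: sup_norm_add)
next
  case (Suc k)
  let ?N = "tsirelson_iter k"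
  have "tsirelson_step ?N (x + y) \<le> tsirelson_step ?N x + tsirelson_step ?N y"
  proof (rule tsirelson_step_le)
    show "sup_norm (x + y) \<le> tsirelson_step ?N x + tsirelson_step ?N y"
      using sup_norm_add[of x y] tsirelson_step_ge_sup[of x ?N] tsirelson_step_ge_sup[of y ?N]
      by linarith
    fix n E assume a: "admissible n E"
    have "(\<Sum>i=1..n. ?N (restr (E i) (x + y)))
        \<le> (\<Sum>i=1..n. ?N (restr (E i) x) + ?N (restr (E i) y))"
      by (rule sum_mono) (simp add: restr_add Suc.IH)
    also have "\<dots> = (\<Sum>i=1..n. ?N (restr (E i) x)) + (\<Sum>i=1..n. ?N (restr (E i) y))"
      by (rule sum.distrib)
    finally show "1/2 * (\<Sum>i=1..n. ?N (restr (E i) (x + y)))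
        \<le> tsirelson_step ?N x + tsirelson_step ?N y"
      using tsirelson_step_ge[of ?N, OF iter_le_ell1 a, of x]
        tsirelson_step_ge[of ?N, OF iter_le_ell1 a, of y] by linarith
  qed
  then show ?case by simp
qed

lemma iter_scale_le: "tsirelson_iter k (c *\<^sub>R x) \<le> \<bar>c\<bar> * tsirelson_iter k x"
proof (induction k arbitrary: x)
  case 0
  show ?case by (simp add: sup_norm_scale_le)
next
  case (Suc k)
  let ?N = "tsirelson_iter k"
  have "tsirelson_step ?N (c *\<^sub>R x) \<le> \<bar>c\<bar> * tsirelson_step ?N x"
  proof (rule tsirelson_step_le)
    show "sup_norm (c *\<^sub>R x) \<le> \<bar>c\<bar> * tsirelson_step ?N x"
      by (rule order_trans[OF sup_norm_scale_le]) (simp add: mult_left_mono tsirelson_step_ge_sup)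
    fix n E assume a: "admissible n E"
    have "1/2 * (\<Sum>i=1..n. ?N (restr (E i) (c *\<^sub>R x)))
        \<le> 1/2 * (\<Sum>i=1..n. \<bar>c\<bar> * ?N (restr (E i) x))"
      by (intro mult_left_mono sum_mono) (simp_all add: restr_scale Suc.IH)
    also have "\<dots> = \<bar>c\<bar> * (1/2 * (\<Sum>i=1..n. ?N (restr (E i) x)))"
      by (simp add: sum_distrib_left)
    also have "\<dots> \<le> \<bar>c\<bar> * tsirelson_step ?N x"
      by (intro mult_left_mono tsirelson_step_ge[OF iter_le_ell1 a]) simp
    finally show "1/2 * (\<Sum>i=1..n. ?N (restr (E i) (c *\<^sub>R x))) \<le> \<bar>c\<bar> * tsirelson_step ?N x" .
  qed
  then show ?case by simp
qed

definition tsirelson_lim :: "c00 \<Rightarrow> real"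
  where "tsirelson_lim x = (SUP k. tsirelson_iter k x)"

lemma bdd_iter: "bdd_above (range (\<lambda>k. tsirelson_iter k x))"
  by (rule bdd_aboveI[of _ "ell1 x"]) (auto simp: iter_le_ell1)

lemma iter_tendsto: "(\<lambda>k. tsirelson_iter k x) \<longlonglongrightarrow> tsirelson_lim x"
  unfolding tsirelson_lim_def
  by (rule LIMSEQ_incseq_SUP[OF bdd_iter]) (rule incseq_SucI, rule iter_mono)

lemma iter_le_lim: "tsirelson_iter k x \<le> tsirelson_lim x"
  unfolding tsirelson_lim_def by (rule cSUP_upper[OF _ bdd_iter]) simp

lemma lim_le_ell1: "tsirelson_lim x \<le> ell1 x"
  unfolding tsirelson_lim_def by (rule cSUP_least) (auto simp: iter_le_ell1)

lemma lim_step: "tsirelson_lim x = tsirelson_step tsirelson_lim x"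
proof (rule antisym)
  show "tsirelson_step tsirelson_lim x \<le> tsirelson_lim x"
  proof (rule tsirelson_step_le)
    show "sup_norm x \<le> tsirelson_lim x" using iter_le_lim[of 0 x] by simp
    fix n E assume a: "admissible n E"
    have "(\<lambda>k. 1/2 * (\<Sum>i=1..n. tsirelson_iter k (restr (E i) x)))
        \<longlonglongrightarrow> 1/2 * (\<Sum>i=1..n. tsirelson_lim (restr (E i) x))"
      by (intro tendsto_intros iter_tendsto)
    moreover have "1/2 * (\<Sum>i=1..n. tsirelson_iter k (restr (E i) x)) \<le> tsirelson_lim x" for k
      using tsirelson_step_ge[of "tsirelson_iter k", OF iter_le_ell1 a, of x]
        iter_le_lim[of "Suc k" x] by simp
    ultimately show "1/2 * (\<Sum>i=1..n. tsirelson_lim (restr (E i) x)) \<le> tsirelson_lim x"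
      by - (rule LIMSEQ_le_const2, assumption, blast)
  qed
  have "tsirelson_iter k x \<le> tsirelson_step tsirelson_lim x" for k
  proof -
    have "tsirelson_iter (Suc k) x \<le> tsirelson_step tsirelson_lim x"
      using tsirelson_step_mono[of "tsirelson_iter k" tsirelson_lim x, OF iter_le_lim lim_le_ell1] by simp
    then show ?thesis using iter_mono[of k x] by linarith
  qed
  then show "tsirelson_lim x \<le> tsirelson_step tsirelson_lim x"
    unfolding tsirelson_lim_def[of x] by (intro cSUP_least) auto
qed

lemma lim_is_norm: "is_norm tsirelson_lim"
proof -
  have ge: "sup_norm x \<le> tsirelson_lim x" for x using iter_le_lim[of 0 x] by simp
  have nn: "0 \<le> tsirelson_lim x" for x using ge[of x] sup_norm_nonneg[of x] by linarith
  have zero: "tsirelson_lim x = 0 \<longleftrightarrow> x = 0" for x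
  proof
    assume "tsirelson_lim x = 0"
    then have "coord x i = 0" for i using ge[of x] abs_coord_le_sup_norm[of x i] by simp
    then show "x = 0" by (intro c00_eqI) (simp add: coord_simps)
  next
    assume "x = 0"
    then have "ell1 x = 0" by (simp add: ell1_def coord_simps)
    then show "tsirelson_lim x = 0" using lim_le_ell1[of x] nn[of x] by simp
  qed
  have add: "tsirelson_lim (x + y) \<le> tsirelson_lim x + tsirelson_lim y" for x y
    by (rule LIMSEQ_le[OF iter_tendsto tendsto_add[OF iter_tendsto iter_tendsto]])
      (auto simp: iter_add)
  have sc_le: "tsirelson_lim (c *\<^sub>R x) \<le> \<bar>c\<bar> * tsirelson_lim x" for c x
    by (rule LIMSEQ_le[OF iter_tendsto tendsto_mult_left[OF iter_tendsto]])
      (auto simp: iter_scale_le)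
  have sc: "tsirelson_lim (c *\<^sub>R x) = \<bar>c\<bar> * tsirelson_lim x" for c x
  proof (cases "c = 0")
    case True
    then show ?thesis using zero[of 0] by simp
  next
    case False
    have "tsirelson_lim (inverse c *\<^sub>R (c *\<^sub>R x)) \<le> \<bar>inverse c\<bar> * tsirelson_lim (c *\<^sub>R x)"
      by (rule sc_le)
    then have "\<bar>c\<bar> * tsirelson_lim x \<le> tsirelson_lim (c *\<^sub>R x)"
      using False by (simp add: field_simps)
    with sc_le[of c x] show ?thesis by linarith
  qed
  show ?thesis unfolding is_norm_def using nn zero add sc by blast
qed

lemma lim_is_tsirelson_norm: "is_tsirelson_norm tsirelson_lim"
  unfolding is_tsirelson_norm_def
  using lim_is_norm bdd_tsirelson_sums[of tsirelson_lim, OF lim_le_ell1] lim_step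
  by (auto simp: tsirelson_step_def)

lemma tsirelson_norm_le:
  assumes N: "is_tsirelson_norm N" and M: "is_tsirelson_norm M"
    and less: "\<And>y. card (supp y) < card (supp x) \<Longrightarrow> N y = M y"
  shows "N x \<le> M x"
proof -
  have M_ge: "1/2 * (\<Sum>i=1..n. M (restr (E i) x)) \<le> M x" if "admissible n E" for n E
  proof -
    have "1/2 * (\<Sum>i=1..n. M (restr (E i) x)) \<le> Sup (tsirelson_sums M x)"
      using M by (intro cSup_upper tsirelson_sumsI that) (simp add: is_tsirelson_norm_def)
    also have "\<dots> \<le> M x" using M unfolding is_tsirelson_norm_def by (metis max.cobounded2)
    finally show ?thesis .
  qed
  have nn: "0 \<le> N x" "0 \<le> M x" and N0: "N 0 = 0"
    using N M by (auto simp: is_tsirelson_norm_def is_norm_def)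
  have sums: "1/2 * (\<Sum>i=1..n. N (restr (E i) x)) \<le> max (M x) (1/2 * N x)"
    if a: "admissible n E" for n E
  proof (cases "\<exists>j\<in>{1..n}. supp x \<subseteq> E j")
    case False
    have "N (restr (E i) x) = M (restr (E i) x)" if "i \<in> {1..n}" for i
    proof (rule less)
      have "supp x \<inter> E i \<subset> supp x" using False that by auto
      then show "card (supp (restr (E i) x)) < card (supp x)"
        unfolding supp_restr by (rule psubset_card_mono[OF finite_supp])
    qed
    then have "1/2 * (\<Sum>i=1..n. N (restr (E i) x)) = 1/2 * (\<Sum>i=1..n. M (restr (E i) x))"
      by simp
    then show ?thesis using M_ge[OF a] by linarith
  next
    case True
    then obtain j where j: "j \<in> {1..n}" "supp x \<subseteq> E j" by auto
    have xj: "restr (E j) x = x"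
      using j(2) by (intro c00_eqI) (auto simp: restr.rep_eq supp_def)
    have x0: "restr (E i) x = 0" if "i \<in> {1..n}" "i \<noteq> j" for i
    proof (rule c00_eqI)
      fix k
      show "coord (restr (E i) x) k = coord 0 k"
        using admissible_unique[OF a that(1) j(1), of k] that(2) j(2)
        by (auto simp: restr.rep_eq coord_simps supp_def)
    qed
    have "(\<Sum>i=1..n. N (restr (E i) x)) = (\<Sum>i=1..n. if i = j then N x else 0)"
      using xj x0 N0 by (intro sum.cong) auto
    also have "\<dots> = N x" using j(1) by simp
    finally show ?thesis by simp
  qed
  have "Sup (tsirelson_sums N x) \<le> max (M x) (1/2 * N x)"
    by (rule cSup_least[OF tsirelson_sums_nonempty]) (metis tsirelson_sumsE sums)
  moreover have "N x = max (sup_norm x) (Sup (tsirelson_sums N x))" "sup_norm x \<le> M x"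
    using N M unfolding is_tsirelson_norm_def by (blast, metis max.cobounded1)
  ultimately have "N x \<le> max (M x) (1/2 * N x)" by linarith
  then show ?thesis using nn by linarith
qed

lemma is_tsirelson_norm_unique:
  assumes "is_tsirelson_norm N" "is_tsirelson_norm M"
  shows "N = M"
proof
  fix x
  show "N x = M x"
  proof (induction "card (supp x)" arbitrary: x rule: less_induct)
    case less
    then show ?case
      using tsirelson_norm_le[OF assms, of x] tsirelson_norm_le[OF assms(2,1), of x]
      by (metis antisym)
  qed
qed

theorem ex1_tsirelson_norm: "\<exists>!N. is_tsirelson_norm N"
  using lim_is_tsirelson_norm is_tsirelson_norm_unique by blast

theorem is_tsirelson_norm: "is_tsirelson_norm tsirelson_norm"
  unfolding tsirelson_norm_def by (rule theI'[OF ex1_tsirelson_norm])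

instantiation c00 :: real_normed_vector
begin

definition "norm_c00 = tsirelson_norm"
definition "sgn_c00 (x :: c00) = inverse (norm x) *\<^sub>R x"
definition "dist_c00 (x :: c00) y = norm (x - y)"
definition
  "(uniformity :: (c00 \<times> c00) filter) = (INF e\<in>{0 <..}. principal {(x, y). dist x y < e})"
definition
  "open (U :: c00 set) \<longleftrightarrow> (\<forall>x\<in>U. \<forall>\<^sub>F (x', y) in uniformity. x' = x \<longrightarrow> y \<in> U)"

instance
proof
  have *: "is_norm tsirelson_norm" using is_tsirelson_norm by (simp add: is_tsirelson_norm_def)
  fix x y :: c00 and a :: real and U :: "c00 set"
  show "norm x = 0 \<longleftrightarrow> x = 0" "norm (x + y) \<le> norm x + norm y"
    "norm (a *\<^sub>R x) = \<bar>a\<bar> * norm x"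
    using * by (auto simp: norm_c00_def is_norm_def)
  show "dist x y = norm (x - y)" by (rule dist_c00_def)
  show "sgn x = inverse (norm x) *\<^sub>R x" by (rule sgn_c00_def)
  show "(uniformity :: (c00 \<times> c00) filter) =
      (INF e\<in>{0 <..}. principal {(x, y). dist x y < e})"
    by (rule uniformity_c00_def)
  show "open U \<longleftrightarrow> (\<forall>x\<in>U. \<forall>\<^sub>F (x', y) in uniformity. x' = x \<longrightarrow> y \<in> U)"
    by (rule open_c00_def)
qed

end

section \<open>Completion of a normed space\<close>

text \<open>Cauchy sequences modulo null sequences. The canonical map \<open>to_completion\<close> is linear and
  isometric with dense range, and the resulting space is complete.\<close>

definition null_rel :: "(nat \<Rightarrow> 'a::real_normed_vector) \<Rightarrow> (nat \<Rightarrow> 'a) \<Rightarrow> bool"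
  where "null_rel X Y \<longleftrightarrow> Cauchy X \<and> Cauchy Y \<and> (\<lambda>n. X n - Y n) \<longlonglongrightarrow> 0"

lemma null_rel_part_equivp:
  "part_equivp (null_rel :: (nat \<Rightarrow> 'a::real_normed_vector) \<Rightarrow> _)"
proof (rule part_equivpI)
  show "\<exists>X :: nat \<Rightarrow> 'a. null_rel X X"
    by (rule exI[of _ "\<lambda>_. 0"]) (simp add: null_rel_def convergent_Cauchy[OF convergent_const])
  show "symp (null_rel :: (nat \<Rightarrow> 'a) \<Rightarrow> _)"
    by (rule sympI) (use tendsto_minus in \<open>fastforce simp: null_rel_def\<close>)
  show "transp (null_rel :: (nat \<Rightarrow> 'a) \<Rightarrow> _)"
  proof (rule transpI)
    fix X Y Z :: "nat \<Rightarrow> 'a"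
    assume "null_rel X Y" "null_rel Y Z"
    then show "null_rel X Z"
      using tendsto_add[of "\<lambda>n. X n - Y n" 0 sequentially "\<lambda>n. Y n - Z n" 0]
      by (simp add: null_rel_def)
  qed
qed

quotient_type (overloaded) 'a completion = "nat \<Rightarrow> 'a::real_normed_vector" / partial: null_rel
  by (rule null_rel_part_equivp)

lemma Cauchy_add:
  fixes X Y :: "nat \<Rightarrow> 'a::real_normed_vector"
  assumes "Cauchy X" "Cauchy Y" shows "Cauchy (\<lambda>n. X n + Y n)"
proof (rule metric_CauchyI)
  fix e :: real assume "0 < e"
  then have e: "0 < e/2" by simp
  obtain M1 M2 where
    1: "\<And>m n. m \<ge> M1 \<Longrightarrow> n \<ge> M1 \<Longrightarrow> dist (X m) (X n) < e/2" and
    2: "\<And>m n. m \<ge> M2 \<Longrightarrow> n \<ge> M2 \<Longrightarrow> dist (Y m) (Y n) < e/2"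
    using metric_CauchyD[OF assms(1) e] metric_CauchyD[OF assms(2) e] by metis
  show "\<exists>M. \<forall>m\<ge>M. \<forall>n\<ge>M. dist (X m + Y m) (X n + Y n) < e"
  proof (intro exI allI impI)
    fix m n assume "m \<ge> max M1 M2" "n \<ge> max M1 M2"
    then show "dist (X m + Y m) (X n + Y n) < e"
      using 1[of m n] 2[of m n] dist_triangle_add[of "X m" "Y m" "X n" "Y n"] by linarith
  qed
qed

lemma Cauchy_scaleR:
  fixes X :: "nat \<Rightarrow> 'a::real_normed_vector"
  shows "Cauchy X \<Longrightarrow> Cauchy (\<lambda>n. c *\<^sub>R X n)"
  by (rule bounded_linear.Cauchy[OF bounded_linear_scaleR_right])

lemma Cauchy_norm:
  fixes X :: "nat \<Rightarrow> 'a::real_normed_vector"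
  assumes "Cauchy X" shows "convergent (\<lambda>n. norm (X n))"
proof (rule Cauchy_convergent, rule metric_CauchyI)
  fix e :: real assume "0 < e"
  then obtain M where M: "\<And>m n. m \<ge> M \<Longrightarrow> n \<ge> M \<Longrightarrow> norm (X m - X n) < e"
    using metric_CauchyD[OF assms] unfolding dist_norm by metis
  show "\<exists>M. \<forall>m\<ge>M. \<forall>n\<ge>M. dist (norm (X m)) (norm (X n)) < e"
    using M by (intro exI[of _ M])
      (auto simp: dist_real_def intro: le_less_trans[OF norm_triangle_ineq3])
qed

lemma null_rel_lim_norm:
  assumes "null_rel X Y"
  shows "lim (\<lambda>n. norm (X n)) = lim (\<lambda>n. norm (Y n))"
proof -
  have Y: "(\<lambda>n. norm (Y n)) \<longlonglongrightarrow> lim (\<lambda>n. norm (Y n))"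
    using assms Cauchy_norm[of Y] by (simp add: null_rel_def convergent_LIMSEQ_iff)
  have "(\<lambda>n. norm (X n) - norm (Y n)) \<longlonglongrightarrow> 0"
  proof (rule tendsto_rabs_zero_cancel, rule Lim_null_comparison)
    show "(\<lambda>n. norm (X n - Y n)) \<longlonglongrightarrow> 0"
      using assms tendsto_norm_zero by (auto simp: null_rel_def)
    show "\<forall>\<^sub>F n in sequentially. norm \<bar>norm (X n) - norm (Y n)\<bar> \<le> norm (X n - Y n)"
      by (simp add: norm_triangle_ineq3)
  qed
  from tendsto_add[OF this Y] show ?thesis by (simp add: limI)
qed

instantiation completion :: (real_normed_vector) real_normed_vector
begin

lift_definition zero_completion :: "'a completion" is "\<lambda>_. 0"
  by (simp add: null_rel_def convergent_Cauchy[OF convergent_const])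

lift_definition plus_completion :: "'a completion \<Rightarrow> 'a completion \<Rightarrow> 'a completion"
  is "\<lambda>X Y n. X n + Y n"
proof -
  fix X X' Y Y' :: "nat \<Rightarrow> 'a"
  assume "null_rel X X'" "null_rel Y Y'"
  then show "null_rel (\<lambda>n. X n + Y n) (\<lambda>n. X' n + Y' n)"
    using tendsto_add[of "\<lambda>n. X n - X' n" 0 sequentially "\<lambda>n. Y n - Y' n" 0]
    by (simp add: null_rel_def Cauchy_add algebra_simps)
qed

lift_definition scaleR_completion :: "real \<Rightarrow> 'a completion \<Rightarrow> 'a completion"
  is "\<lambda>c X n. c *\<^sub>R X n"
proof -
  fix c and X X' :: "nat \<Rightarrow> 'a"
  assume "null_rel X X'"
  then show "null_rel (\<lambda>n. c *\<^sub>R X n) (\<lambda>n. c *\<^sub>R X' n)"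
    using tendsto_scaleR[OF tendsto_const, of "\<lambda>n. X n - X' n" 0 sequentially c]
    by (simp add: null_rel_def Cauchy_scaleR scaleR_diff_right)
qed

lift_definition norm_completion :: "'a completion \<Rightarrow> real" is "\<lambda>X. lim (\<lambda>n. norm (X n))"
  by (rule null_rel_lim_norm)

definition "uminus_completion (x :: 'a completion) = (-1) *\<^sub>R x"
definition "minus_completion (x :: 'a completion) y = x + - y"
definition "sgn_completion (x :: 'a completion) = inverse (norm x) *\<^sub>R x"
definition "dist_completion (x :: 'a completion) y = norm (x - y)"
definition "(uniformity :: ('a completion \<times> 'a completion) filter) =
  (INF e\<in>{0 <..}. principal {(x, y). dist x y < e})"
definition "open (U :: 'a completion set) \<longleftrightarrow>
  (\<forall>x\<in>U. \<forall>\<^sub>F (x', y) in uniformity. x' = x \<longrightarrow> y \<in> U)"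

lemma null_rel_refl: "Cauchy X \<Longrightarrow> null_rel X X"
  by (simp add: null_rel_def)

instance
proof
  fix x y z :: "'a completion" and a b :: real
  show "x + y + z = x + (y + z)"
    by transfer (simp add: null_rel_def Cauchy_add add.assoc)
  show "x + y = y + x"
    by transfer (simp add: null_rel_def Cauchy_add add.commute)
  show "0 + x = x"
    by transfer (simp add: null_rel_def)
  show "- x + x = 0"
    unfolding uminus_completion_def
    by transfer (simp add: null_rel_def convergent_Cauchy[OF convergent_const])
  show "x - y = x + - y" by (rule minus_completion_def)
  show "a *\<^sub>R (x + y) = a *\<^sub>R x + a *\<^sub>R y"
    by transfer (simp add: null_rel_def Cauchy_add Cauchy_scaleR scaleR_add_right)
  show "(a + b) *\<^sub>R x = a *\<^sub>R x + b *\<^sub>R x"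
    by transfer (simp add: null_rel_def Cauchy_add Cauchy_scaleR scaleR_add_left)
  show "a *\<^sub>R b *\<^sub>R x = (a * b) *\<^sub>R x"
    by transfer (simp add: null_rel_def Cauchy_scaleR)
  show "1 *\<^sub>R x = x"
    by transfer (simp add: null_rel_def)
  show "dist x y = norm (x - y)" by (rule dist_completion_def)
  show "sgn x = inverse (norm x) *\<^sub>R x" by (rule sgn_completion_def)
  show "(uniformity :: ('a completion \<times> 'a completion) filter) =
      (INF e\<in>{0 <..}. principal {(x, y). dist x y < e})"
    by (rule uniformity_completion_def)
  show "open U \<longleftrightarrow> (\<forall>x\<in>U. \<forall>\<^sub>F (x', y) in uniformity. x' = x \<longrightarrow> y \<in> U)"
    for U :: "'a completion set"
    by (rule open_completion_def)
  show "norm x = 0 \<longleftrightarrow> x = 0"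
  proof transfer
    fix X :: "nat \<Rightarrow> 'a"
    assume "null_rel X X"
    then have X: "Cauchy X" by (simp add: null_rel_def)
    have "lim (\<lambda>n. norm (X n)) = 0 \<longleftrightarrow> (\<lambda>n. norm (X n)) \<longlonglongrightarrow> 0"
      using Cauchy_norm[OF X] by (metis convergent_LIMSEQ_iff limI)
    also have "\<dots> \<longleftrightarrow> X \<longlonglongrightarrow> 0" by (rule tendsto_norm_zero_iff)
    also have "\<dots> \<longleftrightarrow> null_rel X (\<lambda>_. 0)"
      using X by (simp add: null_rel_def convergent_Cauchy[OF convergent_const])
    finally show "lim (\<lambda>n. norm (X n)) = 0 \<longleftrightarrow> null_rel X (\<lambda>_. 0)" .
  qed
  show "norm (x + y) \<le> norm x + norm y"
  proof transfer
    fix X Y :: "nat \<Rightarrow> 'a"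
    assume "null_rel X X" "null_rel Y Y"
    then have *: "Cauchy X" "Cauchy Y" by (auto simp: null_rel_def)
    have l: "(\<lambda>n. norm (Z n)) \<longlonglongrightarrow> lim (\<lambda>n. norm (Z n))" if "Cauchy Z" for Z :: "nat \<Rightarrow> 'a"
      using Cauchy_norm[OF that] by (simp add: convergent_LIMSEQ_iff)
    show "lim (\<lambda>n. norm (X n + Y n)) \<le> lim (\<lambda>n. norm (X n)) + lim (\<lambda>n. norm (Y n))"
      by (rule LIMSEQ_le[OF l[OF Cauchy_add[OF *]] tendsto_add[OF l[OF *(1)] l[OF *(2)]]])
        (auto simp: norm_triangle_ineq)
  qed
  show "norm (a *\<^sub>R x) = \<bar>a\<bar> * norm x"
  proof transfer
    fix a and X :: "nat \<Rightarrow> 'a"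
    assume "null_rel X X"
    then have "(\<lambda>n. norm (X n)) \<longlonglongrightarrow> lim (\<lambda>n. norm (X n))"
      using Cauchy_norm by (simp add: convergent_LIMSEQ_iff null_rel_def)
    then have "(\<lambda>n. \<bar>a\<bar> * norm (X n)) \<longlonglongrightarrow> \<bar>a\<bar> * lim (\<lambda>n. norm (X n))"
      by (rule tendsto_mult_left)
    then show "lim (\<lambda>n. norm (a *\<^sub>R X n)) = \<bar>a\<bar> * lim (\<lambda>n. norm (X n))"
      by (simp add: limI)
  qed
qed

end

lift_definition to_completion :: "'a::real_normed_vector \<Rightarrow> 'a completion" is "\<lambda>x _. x"
  by (simp add: null_rel_def convergent_Cauchy[OF convergent_const])

lemma to_completion_add: "to_completion (x + y) = to_completion x + to_completion y"
  by transfer (simp add: null_rel_def convergent_Cauchy[OF convergent_const])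

lemma to_completion_scaleR: "to_completion (c *\<^sub>R x) = c *\<^sub>R to_completion x"
  by transfer (simp add: null_rel_def convergent_Cauchy[OF convergent_const])

lemma linear_to_completion: "linear to_completion"
  by (rule linearI) (simp_all add: to_completion_add to_completion_scaleR)

lemma norm_to_completion: "norm (to_completion x) = norm x"
  by transfer simp

lemma to_completion_diff: "to_completion (x - y) = to_completion x - to_completion y"
  by (rule linear_diff[OF linear_to_completion])

lemma to_completion_tendsto:
  assumes X: "Cauchy X"
  shows "(\<lambda>k. to_completion (X k)) \<longlonglongrightarrow> abs_completion X"
proof (rule metric_LIMSEQ_I)
  fix e :: real assume "0 < e"
  then obtain M where M: "\<And>m n. m \<ge> M \<Longrightarrow> n \<ge> M \<Longrightarrow> norm (X m - X n) < e/2"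
    using metric_CauchyD[OF X, of "e/2"] by (auto simp: dist_norm)
  show "\<exists>M. \<forall>k\<ge>M. dist (to_completion (X k)) (abs_completion X) < e"
  proof (intro exI[of _ M] allI impI)
    fix k assume k: "k \<ge> M"
    have c: "Cauchy (\<lambda>_. X k)" by (rule convergent_Cauchy[OF convergent_const])
    have d: "Cauchy (\<lambda>n. X k + - 1 *\<^sub>R X n)"
      using Cauchy_add[OF c Cauchy_scaleR[OF X]] .
    have "to_completion (X k) - abs_completion X = abs_completion (\<lambda>n. X k + - 1 *\<^sub>R X n)"
      unfolding minus_completion_def uminus_completion_def
      by (simp only: to_completion.abs_eq scaleR_completion.abs_eq plus_completion.abs_eq
          null_rel_refl X c Cauchy_scaleR)
    then have "norm (to_completion (X k) - abs_completion X) = lim (\<lambda>n. norm (X k + - 1 *\<^sub>R X n))"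
      using norm_completion.abs_eq[OF null_rel_refl[OF d]] by simp
    also have "\<dots> \<le> e/2"
    proof (rule LIMSEQ_le_const2)
      show "(\<lambda>n. norm (X k + - 1 *\<^sub>R X n)) \<longlonglongrightarrow> lim (\<lambda>n. norm (X k + - 1 *\<^sub>R X n))"
        using Cauchy_norm[OF d] by (simp only: convergent_LIMSEQ_iff)
      show "\<exists>N. \<forall>n\<ge>N. norm (X k + - 1 *\<^sub>R X n) \<le> e/2"
        using M[OF k] by (intro exI[of _ M]) (auto intro: less_imp_le)
    qed
    finally show "dist (to_completion (X k)) (abs_completion X) < e"
      using \<open>0 < e\<close> by (simp add: dist_norm)
  qed
qed

lemma to_completion_approx:
  assumes "0 < e" shows "\<exists>x. dist (to_completion x) z < e"
proof (induction z rule: completion.abs_induct)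
  case (1 X)
  then have "Cauchy X" by (simp add: null_rel_def)
  from metric_LIMSEQ_D[OF to_completion_tendsto[OF this] assms] show ?case by blast
qed

theorem closure_range_to_completion: "closure (range to_completion) = UNIV"
  using to_completion_approx by (auto simp: closure_approachable)

instance completion :: (real_normed_vector) banach
proof
  fix Z :: "nat \<Rightarrow> 'a completion"
  assume Z: "Cauchy Z"
  have "\<exists>x. dist (to_completion x) (Z n) < inverse (real (Suc n))" for n
    by (rule to_completion_approx) simp
  then obtain X where X: "\<And>n. dist (to_completion (X n)) (Z n) < inverse (real (Suc n))"
    by metis
  have null: "(\<lambda>n. to_completion (X n) - Z n) \<longlonglongrightarrow> 0"
    by (rule Lim_null_comparison[OF _ LIMSEQ_inverse_real_of_nat])
      (intro always_eventually allI less_imp_le X[unfolded dist_norm])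
  have "Cauchy (\<lambda>n. (to_completion (X n) - Z n) + Z n)"
    by (rule Cauchy_add[OF LIMSEQ_imp_Cauchy[OF null] Z])
  then have "Cauchy (\<lambda>n. to_completion (X n))" by simp
  then have "Cauchy X"
    by (simp add: Cauchy_def dist_norm norm_to_completion flip: to_completion_diff)
  from tendsto_diff[OF to_completion_tendsto[OF this] null]
  have "Z \<longlonglongrightarrow> abs_completion X" by simp
  then show "convergent Z" by (rule convergentI)
qed

section \<open>Tsirelson's space and iteration stability\<close>

type_synonym tsirelson = "c00 completion"

definition type_determining :: "(nat \<Rightarrow> 'a::banach) \<Rightarrow> bool"
  where "type_determining X \<longleftrightarrow> (\<forall>x. convergent (\<lambda>n. norm (x + X n)))"

definition iteration_stable :: "'a::banach itself \<Rightarrow> bool"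
  where "iteration_stable _ \<longleftrightarrow>
    (\<forall>(X :: nat \<Rightarrow> 'a) Y. type_determining X \<longrightarrow> type_determining Y \<longrightarrow>
      (\<exists>l L. (\<forall>n. (\<lambda>m. norm (X n + Y m)) \<longlonglongrightarrow> l n) \<and> l \<longlonglongrightarrow> L))"

end

theory Submission
  imports Defs
begin

text \<open>
  A type determining sequence remembers how its terms interact with fixed vectors, which all lie
  to the left of its late terms. It forgets how its terms interact with vectors further to the
  right. Two sequences can therefore determine the same type and still behave differently as soon
  as vectors of a third sequence are added far out.

  In Tsirelson's space such a pair is given by the unit vectors \<open>e\<^sub>n\<close> and the flat vectors
  \<open>v\<^sub>n = 2/n (e\<^sub>n\<^sub>+\<^sub>1 + \<dots> + e\<^sub>2\<^sub>n)\<close>. Against an \<open>x\<close> supported in \<open>{..<N}\<close> they are alike: an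
  admissible family that meets the support of \<open>x\<close> has fewer than \<open>N\<close> members, and \<open>N\<close> successive
  pieces of \<open>v\<^sub>n\<close> have norms adding up to at most \<open>1 + 2 N / n\<close>. So, for large \<open>n\<close>, \<open>v\<^sub>n\<close> can
  not be split with profit and acts as a single unit of mass:
  \<open>\<parallel>x + v\<^sub>n\<parallel>\<close> and \<open>\<parallel>x + e\<^sub>n\<parallel>\<close> both tend to \<open>\<parallel>x + e\<^sub>N\<parallel>\<close>. This is
  \<open>tendsto_norm_add_almost_indivisible\<close>, which rests on the two estimates
  \<open>norm_add_unit_vec_le\<close> and \<open>norm_add_le_norm_add_unit_vec\<close>; it passes to the completion because
  \<open>c\<^sub>0\<^sub>0\<close> is dense there. Hence the sequence that takes its terms alternately from the \<open>e\<^sub>n\<close> and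
  the \<open>v\<^sub>n\<close> is type determining.

  To the right the two differ. For \<open>m > 2 n\<close> we have \<open>\<parallel>e\<^sub>n + e\<^sub>m\<parallel> \<le> 1\<close>, whereas the \<open>n + 1\<close>
  indices in the support of \<open>v\<^sub>n + e\<^sub>m\<close> are all at least \<open>n + 1\<close>, hence form an admissible family
  of singletons, and half of the sum of the coordinates is \<open>3/2\<close>. With \<open>e\<^sub>m\<close> as the
  second sequence, the inner limits are at most \<open>1\<close> and at least \<open>3/2\<close> alternately, so that the
  outer limit does not exist.
\<close>

section \<open>The norm on finitely supported sequences\<close>

lemma norm_eq_tsirelson_lim: "norm z = tsirelson_lim z"
  using is_tsirelson_norm_unique[OF is_tsirelson_norm lim_is_tsirelson_norm]
  by (simp add: norm_c00_def)

text \<open>Together, the next two lemmas turn an upper bound for the norm into an induction over the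
  approximating norms \<open>tsirelson_iter k\<close>, in which the pieces of an admissible family are already
  controlled by the previous stage.\<close>

lemma iter_le_norm: "tsirelson_iter k z \<le> norm z"
  by (simp add: norm_eq_tsirelson_lim iter_le_lim)

lemma norm_le_if_iter_le: "(\<And>k. tsirelson_iter k z \<le> B) \<Longrightarrow> norm z \<le> B"
  unfolding norm_eq_tsirelson_lim tsirelson_lim_def by (rule cSUP_least) auto

lemma sup_norm_le_norm: "sup_norm z \<le> norm z"
  using iter_le_norm[of 0] by simp

lemma abs_coord_le_norm: "\<bar>coord z i\<bar> \<le> norm z"
  by (rule order_trans[OF abs_coord_le_sup_norm sup_norm_le_norm])

lemma norm_le_ell1: "norm z \<le> ell1 z"
  by (simp add: norm_eq_tsirelson_lim lim_le_ell1)

lemma iter_mono_abs: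
  assumes "\<And>i. \<bar>coord x i\<bar> \<le> \<bar>coord y i\<bar>"
  shows "tsirelson_iter k x \<le> tsirelson_iter k y"
  using assms
proof (induction k arbitrary: x y)
  case 0
  then show ?case
    by (auto intro!: sup_norm_le intro: order_trans abs_coord_le_sup_norm)
next
  case (Suc k)
  have "tsirelson_step (tsirelson_iter k) x \<le> tsirelson_step (tsirelson_iter k) y"
  proof (rule tsirelson_step_le)
    show "sup_norm x \<le> tsirelson_step (tsirelson_iter k) y"
      by (rule order_trans[OF sup_norm_le tsirelson_step_ge_sup])
        (rule order_trans[OF Suc.prems abs_coord_le_sup_norm])
    fix n E assume a: "admissible n E"
    have "(\<Sum>i=1..n. tsirelson_iter k (restr (E i) x))
        \<le> (\<Sum>i=1..n. tsirelson_iter k (restr (E i) y))"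
      by (intro sum_mono Suc.IH) (simp add: restr.rep_eq Suc.prems)
    then show "1/2 * (\<Sum>i=1..n. tsirelson_iter k (restr (E i) x))
        \<le> tsirelson_step (tsirelson_iter k) y"
      using tsirelson_step_ge[of "tsirelson_iter k", OF iter_le_ell1 a, of y] by linarith
  qed
  then show ?case by simp
qed

lemma norm_mono_abs:
  assumes "\<And>i. \<bar>coord x i\<bar> \<le> \<bar>coord y i\<bar>"
  shows "norm x \<le> norm y"
  by (rule norm_le_if_iter_le) (rule order_trans[OF iter_mono_abs[OF assms] iter_le_norm])

lemma norm_restr_le: "norm (restr E z) \<le> norm z"
  by (rule norm_mono_abs) (simp add: restr.rep_eq)

lemma ell1_nonneg: "0 \<le> ell1 v"
  by (rule order_trans[OF norm_ge_zero norm_le_ell1])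

lemma restr_disjoint: "supp z \<inter> E = {} \<Longrightarrow> restr E z = 0"
  by (rule c00_eqI) (auto simp: restr.rep_eq coord_simps supp_def)

lemma restr_superset: "supp z \<subseteq> E \<Longrightarrow> restr E z = z"
  by (rule c00_eqI) (auto simp: restr.rep_eq coord_simps supp_def)

lemma restr_restr: "restr E (restr F z) = restr (E \<inter> F) z"
  by (rule c00_eqI) (auto simp: restr.rep_eq)

text \<open>A family consisting of one single set is allowed here: its sum is at most \<open>\<parallel>z\<parallel>\<close>, because
  restriction does not increase the norm. This spares a case distinction whenever an admissible
  family is cut off after its first few members.\<close>

lemma sum_norm_admissible_le:
  assumes "1 \<le> n" "\<And>i. i \<in> {1..n} \<Longrightarrow> E i \<noteq> {}" "\<And>a. a \<in> E 1 \<Longrightarrow> n \<le> a"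
    "\<And>i a b. i \<in> {1..<n} \<Longrightarrow> a \<in> E i \<Longrightarrow> b \<in> E (Suc i) \<Longrightarrow> a < b"
  shows "(\<Sum>i=1..n. norm (restr (E i) z)) \<le> 2 * norm z"
proof (cases "n = 1")
  case True
  then show ?thesis using norm_restr_le[of "E 1" z] norm_ge_zero[of z] by (simp; linarith)
next
  case False
  then have "admissible n E" using assms unfolding admissible_def by auto
  then show ?thesis
    using tsirelson_step_ge[of tsirelson_lim, OF lim_le_ell1, of n E z] lim_step[of z]
    by (simp add: norm_eq_tsirelson_lim)
qed

text \<open>The sum over an admissible family carries the factor \<open>1/2\<close>, and the \<open>\<ell>\<^sub>1\<close> norms of the pieces add
  up to at most the \<open>\<ell>\<^sub>1\<close> norm of the whole. For a vector with small coordinates this halves the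
  trivial bound \<open>norm_le_ell1\<close>.\<close>

lemma norm_le_max_sup_ell1: "norm z \<le> max (sup_norm z) (ell1 z / 2)"
proof -
  have "tsirelson_step tsirelson_lim z \<le> max (sup_norm z) (ell1 z / 2)"
  proof (rule tsirelson_step_le)
    fix n E assume "admissible n E"
    then have "(\<Sum>i=1..n. tsirelson_lim (restr (E i) z)) \<le> ell1 z"
      by (rule order_trans[OF sum_mono[OF lim_le_ell1] sum_ell1_restr])
    then show "1/2 * (\<Sum>i=1..n. tsirelson_lim (restr (E i) z)) \<le> max (sup_norm z) (ell1 z / 2)"
      by linarith
  qed simp
  then show ?thesis using lim_step[of z] by (simp add: norm_eq_tsirelson_lim)
qed

text \<open>The singletons of \<open>A\<close>, in increasing order, form an admissible family. Sets with
  \<open>card A \<le> Min A\<close> are known as Schreier sets.\<close>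

lemma schreier_sum_le:
  assumes "finite A" "\<And>a. a \<in> A \<Longrightarrow> card A \<le> a"
  shows "(\<Sum>a\<in>A. \<bar>coord z a\<bar>) \<le> 2 * norm z"
proof (cases "A = {}")
  case False
  define xs where "xs = sorted_list_of_set A"
  have xs: "set xs = A" "length xs = card A" "sorted_wrt (<) xs"
    using assms(1) by (simp_all add: xs_def)
  define E where "E i = {xs ! (i - 1)}" for i
  have pos: "1 \<le> card A" using False assms(1) by (simp add: Suc_leI card_gt_0_iff)
  have "(\<Sum>a\<in>A. \<bar>coord z a\<bar>) = (\<Sum>i<card A. \<bar>coord z (xs ! i)\<bar>)"
    by (rule sum.reindex_bij_betw[symmetric, OF bij_betw_nth])
      (use xs(1,2) in \<open>simp_all add: strict_sorted_iff[THEN iffD1, OF xs(3)]\<close>)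
  also have "\<dots> = (\<Sum>i=1..card A. \<bar>coord z (xs ! (i - 1))\<bar>)"
    by (rule sum.reindex_bij_witness[of _ "\<lambda>i. i - 1" Suc]) auto
  also have "\<dots> \<le> (\<Sum>i=1..card A. norm (restr (E i) z))"
  proof (rule sum_mono)
    fix i
    show "\<bar>coord z (xs ! (i - 1))\<bar> \<le> norm (restr (E i) z)"
      using abs_coord_le_norm[of "restr (E i) z" "xs ! (i - 1)"]
      by (simp add: restr.rep_eq E_def)
  qed
  also have "\<dots> \<le> 2 * norm z"
  proof (rule sum_norm_admissible_le[OF pos])
    fix a assume "a \<in> E 1"
    then have "a \<in> A" using pos nth_mem[of 0 xs] xs(1,2) by (simp add: E_def)
    then show "card A \<le> a" by (rule assms(2))
  next
    fix i a b assume "i \<in> {1..<card A}" "a \<in> E i" "b \<in> E (Suc i)"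
    then show "a < b" using sorted_wrt_nth_less[OF xs(3), of "i - 1" i] xs(2)
      by (auto simp: E_def)
  qed (simp add: E_def)
  finally show ?thesis .
qed simp

section \<open>Replacing a vector far out by a unit vector\<close>

text \<open>The coordinate \<open>0\<close> has to vanish, hence \<open>unit_vec 0 = 0\<close>.\<close>

lift_definition unit_vec :: "nat \<Rightarrow> c00" is "\<lambda>n i. if i = n \<and> n \<noteq> 0 then 1 else 0"
  by (auto intro: finite_subset[of _ "{_}"])

lemma coord_eq_0_right: "supp x \<subseteq> {..<N} \<Longrightarrow> N \<le> i \<Longrightarrow> coord x i = 0"
  by (force simp: supp_def)

lemma coord_eq_0_left: "supp w \<subseteq> {N..} \<Longrightarrow> i < N \<Longrightarrow> coord w i = 0"
  by (force simp: supp_def)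

text \<open>Take an admissible family for \<open>x + a e\<^sub>N\<close>. If none of its members contains \<open>N\<close>, then it sees
  only \<open>x\<close>. Otherwise let the member that contains \<open>N\<close> swallow everything from \<open>N\<close> on, and drop the
  later members, which see nothing of \<open>x + a e\<^sub>N\<close>. The sum over the resulting family is at least as
  large for \<open>x + w\<close>: by induction in the member that has been enlarged, and trivially in the
  earlier ones, which see only \<open>x\<close>.\<close>

lemma norm_add_unit_vec_le:
  assumes x: "supp x \<subseteq> {..<N}" and w: "supp w \<subseteq> {N..}" and a: "0 \<le> a" "a \<le> norm w"
  shows "norm (x + a *\<^sub>R unit_vec N) \<le> norm (x + w)"
proof (rule norm_le_if_iter_le)
  \<comment> \<open>This contains the start of the induction and is needed again, for other \<open>x\<close>, in its step.\<close>
  have base: "sup_norm (x + a *\<^sub>R unit_vec N) \<le> norm (x + w)" if x: "supp x \<subseteq> {..<N}" for x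
  proof (rule sup_norm_le)
    fix i
    have "\<bar>coord (x + w) i\<bar> \<le> norm (x + w)"
      by (rule abs_coord_le_norm)
    moreover have "norm w \<le> norm (x + w)"
    proof (rule norm_mono_abs)
      fix i
      show "\<bar>coord w i\<bar> \<le> \<bar>coord (x + w) i\<bar>"
        using coord_eq_0_right[OF x, of i] coord_eq_0_left[OF w, of i]
        by (cases "i < N") (simp_all add: coord_simps)
    qed
    ultimately show "\<bar>coord (x + a *\<^sub>R unit_vec N) i\<bar> \<le> norm (x + w)"
      using a coord_eq_0_right[OF x, of i] coord_eq_0_left[OF w, of i] norm_ge_zero[of "x + w"]
      by (cases "i < N") (auto simp: coord_simps unit_vec.rep_eq)
  qed
  fix k
  show "tsirelson_iter k (x + a *\<^sub>R unit_vec N) \<le> norm (x + w)"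
    using x
  proof (induction k arbitrary: x)
    case 0
    then show ?case using base by simp
  next
    case (Suc k)
    let ?z = "x + a *\<^sub>R unit_vec N"
    have "tsirelson_step (tsirelson_iter k) ?z \<le> norm (x + w)"
    proof (rule tsirelson_step_le)
      show "sup_norm ?z \<le> norm (x + w)" by (rule base[OF Suc.prems])
      fix n E assume adm: "admissible n E"
      have adm': "2 \<le> n" "\<And>i. i \<in> {1..n} \<Longrightarrow> E i \<noteq> {}" "\<And>a. a \<in> E 1 \<Longrightarrow> n \<le> a"
        "\<And>i a b. i \<in> {1..<n} \<Longrightarrow> a \<in> E i \<Longrightarrow> b \<in> E (Suc i) \<Longrightarrow> a < b"
        using adm unfolding admissible_def by blast+
      have "(\<Sum>i=1..n. tsirelson_iter k (restr (E i) ?z)) \<le> 2 * norm (x + w)"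
      proof (cases "\<exists>j\<in>{1..n}. N \<in> E j")
        case False
        have "(\<Sum>i=1..n. tsirelson_iter k (restr (E i) ?z)) \<le> (\<Sum>i=1..n. norm (restr (E i) (x + w)))"
        proof (rule sum_mono)
          fix i assume "i \<in> {1..n}"
          with False have "N \<notin> E i" by blast
          show "tsirelson_iter k (restr (E i) ?z) \<le> norm (restr (E i) (x + w))"
          proof (intro order_trans[OF iter_le_norm norm_mono_abs])
            fix b
            show "\<bar>coord (restr (E i) ?z) b\<bar> \<le> \<bar>coord (restr (E i) (x + w)) b\<bar>"
              using coord_eq_0_right[OF Suc.prems, of b] coord_eq_0_left[OF w, of b] \<open>N \<notin> E i\<close>
              by (cases "b < N") (auto simp: restr.rep_eq coord_simps unit_vec.rep_eq)
          qed
        qed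
        also have "\<dots> \<le> 2 * norm (x + w)"
          by (rule sum_norm_admissible_le[OF _ adm'(2,3,4)]) (use adm'(1) in auto)
        finally show ?thesis .
      next
        case True
        then obtain j where j: "j \<in> {1..n}" "N \<in> E j" by blast
        define G where "G i = (if i = j then E j \<inter> {..<N} \<union> {N..} else E i)" for i
        have below: "E i \<subseteq> {..<N}" if "1 \<le> i" "i < j" for i
          using admissible_less[OF adm that _ _ j(2)] j(1) by auto
        have above: "E i \<subseteq> {N<..}" if "j < i" "i \<le> n" for i
          using admissible_less[OF adm _ that j(2)] j(1) by auto
        have "(\<Sum>i=1..n. tsirelson_iter k (restr (E i) ?z)) = (\<Sum>i=1..j. tsirelson_iter k (restr (E i) ?z))"
        proof (rule sum.mono_neutral_right)
          show "\<forall>i\<in>{1..n} - {1..j}. tsirelson_iter k (restr (E i) ?z) = 0"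
          proof
            fix i assume "i \<in> {1..n} - {1..j}"
            then have "E i \<subseteq> {N<..}" using above[of i] by auto
            then have "restr (E i) ?z = 0"
              by (intro restr_disjoint)
                (use Suc.prems in \<open>fastforce simp: supp_def coord_simps unit_vec.rep_eq split: if_splits\<close>)
            moreover have "tsirelson_iter k 0 = 0"
              using iter_scale_le[of k 0 0] iter_le_norm[of k 0] iter_add[of k 0 0] by simp
            ultimately show "tsirelson_iter k (restr (E i) ?z) = 0" by simp
          qed
        qed (use j in auto)
        also have "\<dots> \<le> (\<Sum>i=1..j. norm (restr (G i) (x + w)))"
        proof (rule sum_mono)
          fix i assume i: "i \<in> {1..j}"
          show "tsirelson_iter k (restr (E i) ?z) \<le> norm (restr (G i) (x + w))"
          proof (cases "i = j")
            case True
            have 1: "restr (E j) ?z = restr (E j) x + a *\<^sub>R unit_vec N"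
              using j(2) by (intro c00_eqI) (auto simp: restr.rep_eq coord_simps unit_vec.rep_eq)
            have 2: "restr (G j) (x + w) = restr (E j) x + w"
            proof (rule c00_eqI)
              fix b
              show "coord (restr (G j) (x + w)) b = coord (restr (E j) x + w) b"
                using coord_eq_0_right[OF Suc.prems, of b] coord_eq_0_left[OF w, of b]
                by (cases "b < N") (auto simp: restr.rep_eq coord_simps G_def)
            qed
            have "supp (restr (E j) x) \<subseteq> {..<N}" using Suc.prems by (auto simp: supp_restr)
            then show ?thesis unfolding True 1 2 by (rule Suc.IH)
          next
            case False
            have "restr (E i) ?z = restr (G i) (x + w)"
            proof (rule c00_eqI)
              fix b
              have "E i \<subseteq> {..<N}" using below[of i] i False by simp
              then show "coord (restr (E i) ?z) b = coord (restr (G i) (x + w)) b"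
                using False coord_eq_0_left[OF w, of b]
                by (cases "b < N") (auto simp: restr.rep_eq coord_simps unit_vec.rep_eq G_def)
            qed
            then show ?thesis using iter_le_norm by simp
          qed
        qed
        also have "\<dots> \<le> 2 * norm (x + w)"
        proof (rule sum_norm_admissible_le)
          fix b assume "b \<in> G 1"
          moreover have "n \<le> N"
          proof (cases "j = 1")
            case False
            obtain c where "c \<in> E 1" using adm'(2)[of 1] adm'(1) by auto
            then show ?thesis using below[of 1] adm'(3)[of c] j False by force
          qed (use adm'(3)[of N] j in simp)
          ultimately show "j \<le> b" using adm'(3)[of b] j by (auto simp: G_def split: if_splits)
        next
          fix i b c assume i: "i \<in> {1..<j}" "b \<in> G i" "c \<in> G (Suc i)"
          then show "b < c" using below[of i] adm'(4)[of i b c] j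
            by (auto simp: G_def split: if_splits)
        next
          fix i assume "i \<in> {1..j}"
          then show "G i \<noteq> {}" using adm'(2)[of i] j by (auto simp: G_def)
        qed (use j in simp)
        finally show ?thesis .
      qed
      then show "1/2 * (\<Sum>i=1..n. tsirelson_iter k (restr (E i) ?z)) \<le> norm (x + w)" by simp
    qed
    then show ?case by simp
  qed
qed


text \<open>The left-hand side is a convex function of \<open>b\<close>, and the right-hand side contains its values at
  the end points \<open>b = a\<close> and \<open>b = 0\<close>.\<close>

lemma norm_affine_le_max:
  fixes y u :: "'a::real_normed_vector"
  assumes "0 \<le> b" "b \<le> a"
  shows "norm (y + b *\<^sub>R u) + (a - b) \<le> max (norm (y + a *\<^sub>R u)) (norm y + a)"
proof (cases "a = 0")
  case False
  define t where "t = b / a"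
  have t: "0 \<le> t" "t \<le> 1" "b = t * a" using assms False by (auto simp: t_def field_simps)
  have "y + b *\<^sub>R u = t *\<^sub>R (y + a *\<^sub>R u) + (1 - t) *\<^sub>R y"
    by (simp add: t(3) algebra_simps)
  then have "norm (y + b *\<^sub>R u) \<le> t * norm (y + a *\<^sub>R u) + (1 - t) * norm y"
    using t norm_triangle_ineq[of "t *\<^sub>R (y + a *\<^sub>R u)" "(1 - t) *\<^sub>R y"] by simp
  then have "norm (y + b *\<^sub>R u) + (a - b) \<le> t * norm (y + a *\<^sub>R u) + (1 - t) * (norm y + a)"
    by (simp add: t(3) algebra_simps)
  also have "\<dots> \<le> max (norm (y + a *\<^sub>R u)) (norm y + a)"
    using t by (intro convex_bound_le) auto
  finally show ?thesis .
qed (use assms in simp)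

lemma sum_split_at:
  fixes f :: "nat \<Rightarrow> real"
  assumes "j \<in> {1..n}"
  shows "sum f {1..n} = sum f {1..<j} + f j + sum f {j<..n}"
proof -
  have "{1..n} = {1..<j} \<union> insert j {j<..n}" using assms by auto
  then have "sum f {1..n} = sum f {1..<j} + sum f (insert j {j<..n})"
    by (simp only:) (rule sum.union_disjoint; auto)
  then show ?thesis by simp
qed

text \<open>
  The hypothesis on \<open>w\<close> bounds the norm of a piece of \<open>w\<close> by its mass, which is additive, and an error
  \<open>d\<close>; the total mass is \<open>a = c * ell1 w\<close>. An admissible family that does not meet \<open>{..<N}\<close> sees only
  \<open>w\<close>. One that meets \<open>{..<N}\<close> has fewer than \<open>N\<close> members, and the last member \<open>E j\<close> that meets
  \<open>{..<N}\<close> is the only one that can meet \<open>{N..}\<close> as well. By induction \<open>w\<close> may be replaced inside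
  \<open>E j\<close> by \<open>b e\<^sub>N\<close>, where \<open>b\<close> is the mass of \<open>w\<close> in \<open>E j\<close>; the later members contribute, up to
  errors, at most the remaining mass \<open>a - b\<close>. By convexity in \<open>b\<close> (\<open>norm_affine_le_max\<close>) the worst
  case is that the whole mass lies inside \<open>E j\<close> or the whole mass lies after it, where the latter
  requires that \<open>E j\<close> is not the last member of the family. Both cases are realised by an admissible
  family for \<open>x + a e\<^sub>N\<close>.

  The error does not grow with the depth of the induction. The step produces \<open>N d\<close> from the
  induction hypothesis, which is used for one member only, and at most \<open>N d\<close> from the later members, and the
  factor \<open>1/2\<close> of the admissible sum turns the total into \<open>N d\<close> again.
\<close>

lemma norm_add_le_norm_add_unit_vec:
  assumes N: "1 \<le> N" and x: "supp x \<subseteq> {..<N}" and w: "supp w \<subseteq> {N..}"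
    and c: "0 \<le> c" and d: "0 \<le> d" and bd: "\<And>E. norm (restr E w) \<le> c * ell1 (restr E w) + d"
  shows "norm (x + w) \<le> norm (x + (c * ell1 w) *\<^sub>R unit_vec N) + real N * d"
proof (rule norm_le_if_iter_le)
  have Nd: "d \<le> real N * d" using N d mult_right_mono[of 1 "real N" d] by simp
  have coordN: "c * ell1 w \<le> norm (x + (c * ell1 w) *\<^sub>R unit_vec N)"
    if "supp x \<subseteq> {..<N}" for x w
    using abs_coord_le_norm[of "x + (c * ell1 w) *\<^sub>R unit_vec N" N]
      coord_eq_0_right[OF that, of N] N
    by (simp add: coord_simps unit_vec.rep_eq)
  have far: "norm w \<le> norm (x + (c * ell1 w) *\<^sub>R unit_vec N) + real N * d"
    if "supp x \<subseteq> {..<N}" "\<And>E. norm (restr E w) \<le> c * ell1 (restr E w) + d" for x w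
    using coordN[OF that(1), of w] that(2)[of UNIV] Nd by (simp add: restr_superset)
  have base: "sup_norm (x + w) \<le> norm (x + (c * ell1 w) *\<^sub>R unit_vec N) + real N * d"
    if x: "supp x \<subseteq> {..<N}" and w: "supp w \<subseteq> {N..}"
      and bd: "\<And>E. norm (restr E w) \<le> c * ell1 (restr E w) + d" for x w
  proof (rule sup_norm_le)
    fix i
    let ?z = "x + (c * ell1 w) *\<^sub>R unit_vec N"
    show "\<bar>coord (x + w) i\<bar> \<le> norm ?z + real N * d"
    proof (cases "i < N")
      case True
      then have "coord (x + w) i = coord ?z i"
        using coord_eq_0_left[OF w] by (simp add: coord_simps unit_vec.rep_eq)
      then show ?thesis
        using abs_coord_le_norm[of ?z i] Nd d by simp
    next
      case False
      then show ?thesis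
        using abs_coord_le_norm[of w i] far[OF x bd]
          coord_eq_0_right[OF x, of i] by (simp add: coord_simps)
    qed
  qed
  fix k
  show "tsirelson_iter k (x + w) \<le> norm (x + (c * ell1 w) *\<^sub>R unit_vec N) + real N * d"
    using x w bd
  proof (induction k arbitrary: x w)
    case 0
    then show ?case using base by simp
  next
    case (Suc k)
    define a where "a = c * ell1 w"
    define z where "z = x + a *\<^sub>R unit_vec N"
    have a: "0 \<le> a" "a \<le> norm z"
      using c ell1_nonneg coordN[OF Suc.prems(1)] by (auto simp: a_def z_def)
    have "tsirelson_step (tsirelson_iter k) (x + w) \<le> norm z + real N * d"
    proof (rule tsirelson_step_le)
      show "sup_norm (x + w) \<le> norm z + real N * d"
        unfolding z_def a_def by (rule base[OF Suc.prems])
      fix n E assume adm: "admissible n E"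
      have adm': "2 \<le> n" "\<And>i. i \<in> {1..n} \<Longrightarrow> E i \<noteq> {}" "\<And>a. a \<in> E 1 \<Longrightarrow> n \<le> a"
        "\<And>i a b. i \<in> {1..<n} \<Longrightarrow> a \<in> E i \<Longrightarrow> b \<in> E (Suc i) \<Longrightarrow> a < b"
        using adm unfolding admissible_def by blast+
      have w_only: "restr F (x + w) = restr F w" if "F \<subseteq> {N..}" for F
        using coord_eq_0_right[OF Suc.prems(1)] that
        by (intro c00_eqI) (auto simp: restr.rep_eq coord_simps)
      have x_only: "restr F (x + w) = restr F x" "restr F z = restr F x" if "F \<subseteq> {..<N}" for F
        using coord_eq_0_left[OF Suc.prems(2)] that
        by (auto intro!: c00_eqI simp: restr.rep_eq coord_simps z_def unit_vec.rep_eq)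
      have "(\<Sum>i=1..n. tsirelson_iter k (restr (E i) (x + w))) \<le> 2 * (norm z + real N * d)"
      proof (cases "\<exists>j\<in>{1..n}. E j \<inter> {..<N} \<noteq> {}")
        case False
        have "(\<Sum>i=1..n. tsirelson_iter k (restr (E i) (x + w)))
            \<le> (\<Sum>i=1..n. norm (restr (E i) w))"
        proof (rule sum_mono)
          fix i assume "i \<in> {1..n}"
          then have "E i \<subseteq> {N..}" using False by (force simp: not_less[symmetric])
          then show "tsirelson_iter k (restr (E i) (x + w)) \<le> norm (restr (E i) w)"
            by (simp add: w_only iter_le_norm)
        qed
        also have "\<dots> \<le> 2 * norm w"
          by (rule sum_norm_admissible_le[OF _ adm'(2,3,4)]) (use adm'(1) in auto)
        finally show ?thesis using far[OF Suc.prems(1,3)] by (simp add: z_def a_def)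
      next
        case True
        define j where "j = Max {j \<in> {1..n}. E j \<inter> {..<N} \<noteq> {}}"
        have "j \<in> {j \<in> {1..n}. E j \<inter> {..<N} \<noteq> {}}"
          unfolding j_def by (rule Max_in) (use True in auto)
        then obtain p where j: "j \<in> {1..n}" and p: "p \<in> E j" "p < N" by auto
        have above: "E i \<subseteq> {N..}" if "i \<in> {j<..n}" for i
        proof (rule ccontr)
          assume "\<not> E i \<subseteq> {N..}"
          then have "i \<le> j" unfolding j_def using that j by (intro Max_ge) auto
          then show False using that by simp
        qed
        have below: "E i \<subseteq> {..<N}" if "i \<in> {1..<j}" for i
          using admissible_less[OF adm _ _ _ _ p(1), of i] j that p(2) by force
        have "n \<le> p"
        proof (cases "j = 1")
          case False
          obtain q where "q \<in> E 1" using adm'(1) adm'(2)[of 1] by auto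
          then show ?thesis
            using adm'(3)[of q] admissible_less[OF adm _ _ _ _ p(1), of 1 q] j False by force
        qed (use adm'(3)[of p] p in simp)
        then have nN: "n < N" using p by simp
        define b where "b = c * ell1 (restr (E j) w)"
        define y where "y = restr (E j) x"
        define P where "P = (\<Sum>i\<in>{1..<j}. norm (restr (E i) x))"
        define T where "T = (\<Sum>i\<in>{j<..n}. c * ell1 (restr (E i) w))"
        have b: "0 \<le> b" using c ell1_nonneg by (simp add: b_def)
        have T: "0 \<le> T" unfolding T_def using c ell1_nonneg by (intro sum_nonneg) simp
        have bT: "b + T \<le> a"
        proof -
          have "b + T \<le> (\<Sum>i=1..n. c * ell1 (restr (E i) w))"
            unfolding sum_split_at[OF j] b_def T_def
            using c ell1_nonneg by (simp add: sum_nonneg)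
          also have "\<dots> \<le> a"
            unfolding a_def sum_distrib_left[symmetric]
            by (rule mult_left_mono[OF sum_ell1_restr[OF adm] c])
          finally show ?thesis .
        qed
        have head: "(\<Sum>i\<in>{1..<j}. tsirelson_iter k (restr (E i) (x + w))) \<le> P"
          unfolding P_def
          by (intro sum_mono, subst x_only(1)) (use below iter_le_norm in auto)
        have mid: "tsirelson_iter k (restr (E j) (x + w)) \<le> norm (y + b *\<^sub>R unit_vec N) + real N * d"
          unfolding restr_add y_def b_def
          by (rule Suc.IH) (use Suc.prems in \<open>auto simp: supp_restr restr_restr\<close>)
        have tail: "(\<Sum>i\<in>{j<..n}. tsirelson_iter k (restr (E i) (x + w))) \<le> T + real N * d"
        proof -
          have "(\<Sum>i\<in>{j<..n}. tsirelson_iter k (restr (E i) (x + w)))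
              \<le> (\<Sum>i\<in>{j<..n}. c * ell1 (restr (E i) w) + d)"
            by (intro sum_mono, subst w_only[OF above], assumption)
              (rule order_trans[OF iter_le_norm Suc.prems(3)])
          also have "\<dots> = T + real (n - j) * d" by (simp add: sum.distrib T_def)
          also have "real (n - j) * d \<le> real N * d" using nN d by (intro mult_right_mono) auto
          finally show ?thesis by simp
        qed
        \<comment> \<open>The whole mass lies inside \<open>E j\<close>: let \<open>E j\<close> take \<open>N\<close> as its only point beyond \<open>{..<N}\<close>.\<close>
        have A: "P + norm (y + a *\<^sub>R unit_vec N) \<le> 2 * norm z"
        proof -
          define G where "G i = (if i = j then E j \<inter> {..<N} \<union> {N} else E i)" for i
          have "restr (G j) z = y + a *\<^sub>R unit_vec N"
          proof (rule c00_eqI)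
            fix i
            show "coord (restr (G j) z) i = coord (y + a *\<^sub>R unit_vec N) i"
              using coord_eq_0_right[OF Suc.prems(1), of i]
              by (cases "i < N") (auto simp: restr.rep_eq coord_simps G_def z_def y_def unit_vec.rep_eq)
          qed
          moreover have "P = (\<Sum>i\<in>{1..<j}. norm (restr (G i) z))"
            unfolding P_def by (intro sum.cong refl) (use x_only(2)[OF below] in \<open>auto simp: G_def\<close>)
          ultimately have "P + norm (y + a *\<^sub>R unit_vec N) = (\<Sum>i=1..j. norm (restr (G i) z))"
            using j by (subst sum_split_at[of j j]) auto
          also have "\<dots> \<le> 2 * norm z"
          proof (rule sum_norm_admissible_le)
            fix q assume "q \<in> G 1"
            then show "j \<le> q" using adm'(3)[of q] j nN by (auto simp: G_def split: if_splits)
          next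
            fix i q r assume "i \<in> {1..<j}" "q \<in> G i" "r \<in> G (Suc i)"
            then show "q < r" using below[of i] adm'(4)[of i q r] j
              by (auto simp: G_def split: if_splits)
          next
            fix i assume "i \<in> {1..j}"
            then show "G i \<noteq> {}" using adm'(2)[of i] j by (auto simp: G_def)
          qed (use j in simp)
          finally show ?thesis .
        qed
        \<comment> \<open>The whole mass lies after \<open>E j\<close>: let \<open>{N}\<close> be a member of its own. As \<open>j < n\<close>, the number of
          members is still at most \<open>n\<close>, as required for admissibility.\<close>
        have B: "P + norm y + a \<le> 2 * norm z" if "j < n"
        proof -
          define G where "G i = (if i = Suc j then {N} else E i \<inter> {..<N})" for i
          have eq: "norm (restr (G i) z) = norm (restr (E i) x)" if "i \<in> {1..j}" for i
          proof -
            have "restr (G i) z = restr (E i \<inter> {..<N}) x"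
              using that by (subst x_only(2)) (auto simp: G_def)
            also have "\<dots> = restr (E i) (restr {..<N} x)" by (simp add: restr_restr)
            finally show ?thesis using Suc.prems(1) by (simp add: restr_superset)
          qed
          have "\<bar>coord z N\<bar> = a"
            using a N coord_eq_0_right[OF Suc.prems(1), of N] by (simp add: z_def coord_simps unit_vec.rep_eq)
          then have "a \<le> norm (restr (G (Suc j)) z)"
            using abs_coord_le_norm[of "restr (G (Suc j)) z" N]
            by (simp add: restr.rep_eq G_def)
          moreover have "P + norm y = (\<Sum>i=1..j. norm (restr (G i) z))"
            using j eq by (subst sum_split_at[of j j]) (auto simp: P_def y_def)
          ultimately have "P + norm y + a \<le> (\<Sum>i=1..Suc j. norm (restr (G i) z))" by simp
          also have "\<dots> \<le> 2 * norm z"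
          proof (rule sum_norm_admissible_le)
            fix q assume "q \<in> G 1"
            then show "Suc j \<le> q" using adm'(3)[of q] j that by (auto simp: G_def split: if_splits)
          next
            fix i q r assume "i \<in> {1..<Suc j}" "q \<in> G i" "r \<in> G (Suc i)"
            then show "q < r" using adm'(4)[of i q r] j
              by (auto simp: G_def split: if_splits)
          next
            fix i assume i: "i \<in> {1..Suc j}"
            show "G i \<noteq> {}"
            proof (cases "i < j")
              case True
              then show ?thesis using below[of i] adm'(2)[of i] i j by (auto simp: G_def)
            next
              case False
              then have "i = j \<or> i = Suc j" using i by auto
              then show ?thesis using p by (auto simp: G_def)
            qed
          qed simp
          finally show ?thesis .
        qed
        have "P + norm (y + b *\<^sub>R unit_vec N) + T \<le> 2 * norm z"
        proof (cases "j < n")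
          case True
          then show ?thesis
            using norm_affine_le_max[of b a y "unit_vec N"] A B b T bT by (simp add: max_def split: if_splits)
        next
          case False
          then have "T = 0" by (simp add: T_def)
          have "norm (y + b *\<^sub>R unit_vec N) \<le> norm (y + a *\<^sub>R unit_vec N)"
          proof (rule norm_mono_abs)
            fix i
            show "\<bar>coord (y + b *\<^sub>R unit_vec N) i\<bar> \<le> \<bar>coord (y + a *\<^sub>R unit_vec N) i\<bar>"
              using coord_eq_0_right[OF Suc.prems(1), of i] b T bT
              by (auto simp: y_def restr.rep_eq coord_simps unit_vec.rep_eq)
          qed
          then show ?thesis using A \<open>T = 0\<close> by simp
        qed
        then show ?thesis using head mid tail unfolding sum_split_at[OF j] by simp
      qed
      then show "1/2 * (\<Sum>i=1..n. tsirelson_iter k (restr (E i) (x + w))) \<le> norm z + real N * d"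
        by simp
    qed
    then show ?case by (simp add: z_def a_def)
  qed
qed

section \<open>Sequences with the same type\<close>

text \<open>If \<open>d\<close> is small, then few successive pieces of \<open>w\<close> have norms adding up to little more than
  \<open>c * ell1 w = 1 \<le> norm w\<close>, so that \<open>w\<close> looks like a single unit of mass. The factor \<open>c\<close> is \<open>1\<close>
  for unit vectors and \<open>1/2\<close> for flat vectors.\<close>

definition almost_indivisible :: "real \<Rightarrow> c00 \<Rightarrow> bool"
  where "almost_indivisible d w \<longleftrightarrow> 1 \<le> norm w \<and>
    (\<exists>c\<ge>0. c * ell1 w = 1 \<and> (\<forall>E. norm (restr E w) \<le> c * ell1 (restr E w) + d))"

text \<open>The limit does not depend on \<open>w\<close>: all such sequences determine the same type, that of the unit
  vectors.\<close>

lemma tendsto_norm_add_almost_indivisible: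
  assumes N: "1 \<le> N" "supp x \<subseteq> {..<N}"
    and w: "\<And>n. supp (w n) \<subseteq> {n..}" "\<And>n. almost_indivisible (d n) (w n)"
    and d: "\<And>n. 0 \<le> d n" "d \<longlonglongrightarrow> 0"
  shows "(\<lambda>n. norm (x + w n)) \<longlonglongrightarrow> norm (x + unit_vec N)"
proof (rule tendsto_sandwich)
  have supp: "supp (w n) \<subseteq> {N..}" if "N \<le> n" for n using w(1)[of n] that by auto
  show "\<forall>\<^sub>F n in sequentially. norm (x + unit_vec N) \<le> norm (x + w n)"
    using norm_add_unit_vec_le[OF N(2) supp, of _ 1] w(2)
    by (intro eventually_sequentiallyI[of N]) (auto simp: almost_indivisible_def)
  show "\<forall>\<^sub>F n in sequentially. norm (x + w n) \<le> norm (x + unit_vec N) + real N * d n"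
  proof (rule eventually_sequentiallyI)
    fix n assume n: "N \<le> n"
    obtain c where "0 \<le> c" "c * ell1 (w n) = 1"
      "\<And>E. norm (restr E (w n)) \<le> c * ell1 (restr E (w n)) + d n"
      using w(2)[of n] by (auto simp: almost_indivisible_def)
    then show "norm (x + w n) \<le> norm (x + unit_vec N) + real N * d n"
      using norm_add_le_norm_add_unit_vec[OF N supp[OF n], of c "d n"] d(1)[of n] by simp
  qed
  show "(\<lambda>n. norm (x + unit_vec N) + real N * d n) \<longlonglongrightarrow> norm (x + unit_vec N)"
    using tendsto_add[OF tendsto_const tendsto_mult[OF tendsto_const d(2)]] by force
qed simp

text \<open>All the functions \<open>z \<mapsto> \<parallel>z + w\<^sub>n\<parallel>\<close> are \<open>1\<close>-Lipschitz, so convergence on a dense subspace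
  is enough.\<close>

lemma type_determining_to_completion:
  fixes w :: "nat \<Rightarrow> 'a::real_normed_vector"
  assumes "\<And>x. convergent (\<lambda>n. norm (x + w n))"
  shows "type_determining (\<lambda>n. to_completion (w n))"
  unfolding type_determining_def
proof (intro allI Cauchy_convergent metric_CauchyI)
  fix z :: "'a completion" and e :: real assume "0 < e"
  then have e: "0 < e / 3" by simp
  obtain x where x: "dist (to_completion x) z < e / 3" using to_completion_approx[OF e] by blast
  have close: "dist (norm (z + to_completion (w n))) (norm (x + w n)) < e / 3" for n
  proof -
    have "dist (norm (z + to_completion (w n))) (norm (x + w n))
        = \<bar>norm (z + to_completion (w n)) - norm (to_completion x + to_completion (w n))\<bar>"
      by (simp add: dist_real_def norm_to_completion flip: to_completion_add)
    also have "\<dots> \<le> norm (z - to_completion x)"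
      using norm_triangle_ineq3[of "z + to_completion (w n)" "to_completion x + to_completion (w n)"]
      by simp
    finally show ?thesis using x by (simp add: dist_norm norm_minus_commute)
  qed
  obtain M where M: "\<And>m n. m \<ge> M \<Longrightarrow> n \<ge> M \<Longrightarrow> dist (norm (x + w m)) (norm (x + w n)) < e / 3"
    using metric_CauchyD[OF convergent_Cauchy[OF assms[of x]] e] by blast
  show "\<exists>M. \<forall>m\<ge>M. \<forall>n\<ge>M. dist (norm (z + to_completion (w m))) (norm (z + to_completion (w n))) < e"
  proof (intro exI allI impI)
    fix m n assume "M \<le> m" "M \<le> n"
    then show "dist (norm (z + to_completion (w m))) (norm (z + to_completion (w n))) < e"
      using M[of m n] close[of m] close[of n] unfolding dist_real_def by linarith
  qed
qed

lemma type_determining_almost_indivisible: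
  assumes "\<And>n. supp (w n) \<subseteq> {n..}" "\<And>n. almost_indivisible (d n) (w n)"
    and "\<And>n. 0 \<le> d n" "d \<longlonglongrightarrow> 0"
  shows "type_determining (\<lambda>n. to_completion (w n))"
proof (rule type_determining_to_completion)
  fix x
  obtain N where "\<forall>i\<in>supp x. i < N" using finite_supp[of x] finite_nat_set_iff_bounded by blast
  then have "1 \<le> Suc N" "supp x \<subseteq> {..<Suc N}" by auto
  from tendsto_norm_add_almost_indivisible[OF this assms]
  show "convergent (\<lambda>n. norm (x + w n))" by (rule convergentI)
qed

section \<open>Unit vectors and flat vectors\<close>

lemma supp_unit_vec: "0 < n \<Longrightarrow> supp (unit_vec n) = {n}"
  by (auto simp: supp_def unit_vec.rep_eq)

lemma ell1_unit_vec: "0 < n \<Longrightarrow> ell1 (unit_vec n) = 1"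
  by (simp add: ell1_def supp_unit_vec unit_vec.rep_eq)

text \<open>The \<open>n\<close> nonzero coordinates start at \<open>n + 1\<close> instead of \<open>n\<close>. This leaves room for one more
  coordinate to the right: together with it they still form a Schreier set.\<close>

lift_definition flat_vec :: "nat \<Rightarrow> c00" is "\<lambda>n i. if n < i \<and> i \<le> 2 * n then 2 / real n else 0"
  by (auto intro: finite_subset[of _ "{..2 * _}"])

lemma supp_flat_vec: "supp (flat_vec n) = {n<..2 * n}"
  by (auto simp: supp_def flat_vec.rep_eq)

lemma ell1_flat_vec:
  assumes "0 < n"
  shows "ell1 (flat_vec n) = 2"
proof -
  have "ell1 (flat_vec n) = (\<Sum>i\<in>{n<..2 * n}. 2 / real n)"
    unfolding ell1_def supp_flat_vec by (intro sum.cong) (auto simp: flat_vec.rep_eq)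
  then show ?thesis using assms by simp
qed

lemma almost_indivisible_unit_vec:
  assumes "0 < n"
  shows "almost_indivisible 0 (unit_vec n)"
proof -
  have "1 \<le> norm (unit_vec n)"
    using abs_coord_le_norm[of "unit_vec n" n] assms
    by (simp add: unit_vec.rep_eq)
  then show ?thesis
    unfolding almost_indivisible_def
    by (intro conjI exI[of _ 1]) (simp_all add: ell1_unit_vec[OF assms] norm_le_ell1)
qed

lemma almost_indivisible_mono: "almost_indivisible d w \<Longrightarrow> d \<le> d' \<Longrightarrow> almost_indivisible d' w"
  unfolding almost_indivisible_def by (meson add_left_mono order_trans)

text \<open>Testing on singletons gives half of the \<open>\<ell>\<^sub>1\<close> norm, here \<open>(2 + 1) / 2\<close>.\<close>

lemma norm_flat_vec_add_unit_vec_ge: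
  assumes "0 < n" "2 * n < m"
  shows "3 / 2 \<le> norm (flat_vec n + unit_vec m)"
proof -
  let ?v = "flat_vec n + unit_vec m"
  have "(\<Sum>a\<in>insert m {n<..2 * n}. \<bar>coord ?v a\<bar>)
      = \<bar>coord ?v m\<bar> + (\<Sum>a\<in>{n<..2 * n}. \<bar>coord ?v a\<bar>)"
    using assms by simp
  also have "(\<Sum>a\<in>{n<..2 * n}. \<bar>coord ?v a\<bar>) = (\<Sum>a\<in>{n<..2 * n}. 2 / real n)"
    using assms by (intro sum.cong) (auto simp: coord_simps flat_vec.rep_eq unit_vec.rep_eq)
  also have "\<bar>coord ?v m\<bar> = 1"
    using assms by (simp add: coord_simps flat_vec.rep_eq unit_vec.rep_eq)
  finally have "(\<Sum>a\<in>insert m {n<..2 * n}. \<bar>coord ?v a\<bar>) = 3" using assms by simp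
  moreover have "(\<Sum>a\<in>insert m {n<..2 * n}. \<bar>coord ?v a\<bar>) \<le> 2 * norm ?v"
    using assms by (intro schreier_sum_le) auto
  ultimately show ?thesis by simp
qed

text \<open>Only a piece that consists of a single coordinate can have a norm above half of its \<open>\<ell>\<^sub>1\<close> norm, and
  the error \<open>2 / n\<close> is the size of a coordinate.\<close>

lemma almost_indivisible_flat_vec:
  assumes "0 < n"
  shows "almost_indivisible (2 / real n) (flat_vec n)"
proof -
  have "(\<Sum>a\<in>{n<..2 * n}. \<bar>coord (flat_vec n) a\<bar>) \<le> 2 * norm (flat_vec n)"
    by (intro schreier_sum_le) auto
  then have "1 \<le> norm (flat_vec n)"
    using ell1_flat_vec[OF assms] by (simp add: ell1_def supp_flat_vec)
  moreover have "norm (restr E (flat_vec n)) \<le> 1/2 * ell1 (restr E (flat_vec n)) + 2 / real n" for E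
  proof -
    have "sup_norm (restr E (flat_vec n)) \<le> 2 / real n"
      by (rule sup_norm_le) (simp add: restr.rep_eq flat_vec.rep_eq)
    moreover have "0 \<le> ell1 (restr E (flat_vec n))" by (rule ell1_nonneg)
    moreover have "0 \<le> 2 / real n" by simp
    ultimately show ?thesis
      using norm_le_max_sup_ell1[of "restr E (flat_vec n)"] by linarith
  qed
  ultimately show ?thesis
    unfolding almost_indivisible_def by (intro conjI exI[of _ "1/2"]) (simp_all add: ell1_flat_vec[OF assms])
qed

lemma norm_unit_vec_add_unit_vec:
  assumes "i \<noteq> j"
  shows "norm (unit_vec i + unit_vec j) \<le> 1"
proof -
  have "supp (unit_vec i + unit_vec j) \<subseteq> {i, j}"
    by (auto simp: supp_def coord_simps unit_vec.rep_eq split: if_splits)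
  then have "ell1 (unit_vec i + unit_vec j) \<le> (\<Sum>a\<in>{i, j}. \<bar>coord (unit_vec i + unit_vec j) a\<bar>)"
    unfolding ell1_def by (intro sum_mono2) auto
  also have "\<dots> \<le> 2" using assms by (simp add: coord_simps unit_vec.rep_eq)
  finally have "ell1 (unit_vec i + unit_vec j) \<le> 2" .
  moreover have "sup_norm (unit_vec i + unit_vec j) \<le> 1"
    by (rule sup_norm_le) (use assms in \<open>simp add: coord_simps unit_vec.rep_eq\<close>)
  ultimately show ?thesis using norm_le_max_sup_ell1[of "unit_vec i + unit_vec j"] by linarith
qed

section \<open>Failure of iteration stability\<close>

theorem theorem4p3:
  shows "\<not> iteration_stable TYPE(tsirelson)"
proof
  assume stable: "iteration_stable TYPE(tsirelson)"
  \<comment> \<open>The shift by one in the unit vectors avoids \<open>unit_vec 0 = 0\<close>.\<close>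
  define u where "u n = (if even n then unit_vec (Suc n) else flat_vec n)" for n
  define X where "X n = to_completion (u n)" for n
  define Y where "Y n = to_completion (unit_vec (Suc n))" for n
  have "type_determining X"
    unfolding X_def
  proof (rule type_determining_almost_indivisible)
    fix n
    show "supp (u n) \<subseteq> {n..}" by (auto simp: u_def supp_unit_vec supp_flat_vec)
    show "almost_indivisible (2 / real n) (u n)"
      using almost_indivisible_mono[OF almost_indivisible_unit_vec, of "Suc n" "2 / real n"]
        almost_indivisible_flat_vec[of n]
      by (auto simp: u_def odd_pos)
    show "(\<lambda>n. 2 / real n) \<longlonglongrightarrow> 0" by (rule lim_const_over_n)
  qed simp
  moreover have "type_determining Y"
    unfolding Y_def
    by (rule type_determining_almost_indivisible[where d = "\<lambda>_. 0"])
      (auto simp: supp_unit_vec almost_indivisible_unit_vec)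
  ultimately obtain l L where l: "\<And>n. (\<lambda>m. norm (X n + Y m)) \<longlonglongrightarrow> l n" and L: "l \<longlonglongrightarrow> L"
    using stable unfolding iteration_stable_def by blast
  have norm_XY: "norm (X n + Y m) = norm (u n + unit_vec (Suc m))" for n m
    by (simp add: X_def Y_def norm_to_completion flip: to_completion_add)
  have "l (2 * n) \<le> 1" for n
    using l by (rule LIMSEQ_le_const2)
      (auto intro!: exI[of _ "Suc (2 * n)"] norm_unit_vec_add_unit_vec simp: norm_XY u_def)
  then have "L \<le> 1"
    using LIMSEQ_le_const2[OF LIMSEQ_subseq_LIMSEQ[OF L, of "\<lambda>n. 2 * n"], of 1]
    by (auto simp: strict_mono_def)
  moreover have "3 / 2 \<le> l (2 * n + 1)" for n
  proof (rule LIMSEQ_le_const[OF l], intro exI allI impI)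
    fix m assume "2 * (2 * n + 1) \<le> m"
    then show "3 / 2 \<le> norm (X (2 * n + 1) + Y m)"
      using norm_flat_vec_add_unit_vec_ge[of "2 * n + 1" "Suc m"] by (simp add: norm_XY u_def)
  qed
  then have "3 / 2 \<le> L"
    using LIMSEQ_le_const[OF LIMSEQ_subseq_LIMSEQ[OF L, of "\<lambda>n. 2 * n + 1"], of "3 / 2"]
    by (auto simp: strict_mono_def)
  ultimately show False by simp
qed

end
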